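(* Let $m\ge 1$ and $X=\{x_0,x_1,\dots,x_m\}$. With the coordinate maps $a^i_\eta$, the graded commutative algebra $(H,\mu)$ they freely generate, and the coproduct $\Delta$ on $H$ defined by $\Delta a^i_\eta(c,d)=(c_i\circledcirc d,\eta)$ (all as specified in the context), $(H,\mu,\Delta)$ is a connected graded commutative unital Hopf algebra.
   Context: $X=\{x_0,\dots,x_m\}$ is an alphabet of noncommuting letters, $X^*$ the monoid of words including the empty word $\emptyset$, $|\eta|_{x_i}$ the number of occurrences of $x_i$ in $\eta$. $\mathbb{R}^\ell\langle\langle X\rangle\rangle$ is the set of formal power series $c:X^*\to\mathbb{R}^\ell$, $c=\sum_{\eta}(c,\eta)\eta$; $c_i$ is the $i$-th component series. The shuffle product $\sqcup\!\sqcup$ is the bilinear product with $(x_i\eta)\sqcup\!\sqcup(x_j\xi)=x_i(\eta\sqcup\!\sqcup(x_j\xi))+x_j((x_i\eta)\sqcup\!\sqcup\xi)$, $\eta\sqcup\!\sqcup\emptyset=\emptyset\sqcup\!\sqcup\eta=\eta$. Modified composition product: for $c\in\mathbb{R}^\ell\langle\langle X\rangle\rangle$, $d\in\mathbb{R}^m\langle\langle X\rangle\rangle$, $c\,\tilde\circ\,d=\sum_{\eta\in X^*}(c,\eta)\,\phi_d(\eta)(1)$, where $\phi_d$ is the continuous (in the ultrametric sense) algebra homomorphism from $\mathbb{R}\langle\langle X\rangle\rangle$ to $\mathrm{End}(\mathbb{R}\langle\langle X\rangle\rangle)$ with $\phi_d(x_i\eta)=\phi_d(x_i)\circ\phi_d(\eta)$,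 $\phi_d(x_i)(e)=x_ie+x_0(d_i\sqcup\!\sqcup e)$ for $i=0,\dots,m$ with $d_0:=0$, and $\phi_d(\emptyset)=\mathrm{id}$. For $c,d\in\mathbb{R}^m\langle\langle X\rangle\rangle$ set $c\circledcirc d:=d+c\,\tilde\circ\,d$ (an associative product); $c_i\circledcirc d$ denotes the $i$-th component $(c\circledcirc d)_i$. Coordinate maps: $a^i_\eta:\mathbb{R}^m\langle\langle X\rangle\rangle\to\mathbb{R}$, $c\mapsto(c_i,\eta)$, for $\eta\in X^*$, $i=1,\dots,m$, with degree $\deg(a^i_\eta)=2|\eta|_{x_0}+\sum_{j=1}^m|\eta|_{x_j}+1$. Let $V_n=\mathrm{span}_{\mathbb{R}}\{a^i_\eta:\deg(a^i_\eta)=n\}$ for $n>0$ and $V_0=\mathbb{R}\mathbf{1}$, where $\mathbf{1}$ maps every $c$ to $1$; $V=\bigoplus_{n\ge0}V_n$, $V_+=\bigoplus_{n>0}V_n$. $H$ is the free unital commutative $\mathbb{R}$-algebra generated by the $a^i_\eta$, with product $\mu:a^i_\eta\otimes a^j_\xi\mapsto a^i_\eta a^j_\xi$, unit $\mathbf{1}$, and grading $H=\bigoplus_{n\ge0}H_n$ induced by $\deg(a^i_\eta a^j_\xi)=\deg(a^i_\eta)+\deg(a^j_\xi)$, $\deg(\mathbf{1})=0$; $H_0=\mathbb{R}\mathbf{1}$. Elements of $H$ are viewed as functions on $\mathbb{R}^m\langle\langle X\rangle\rangle$ and elements of $H\otimes H$ as functions of two series via $(f\otimes g)(c,d)=f(c)g(d)$.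 The coproduct $\Delta:H\to H\otimes H$ is given on generators by $\Delta a^i_\eta(c,d)=a^i_\eta(c\circledcirc d)=(c_i\circledcirc d,\eta)$ and extended as a unital algebra morphism. The counit $\varepsilon$ is the algebra morphism with $\varepsilon(a^i_\eta)=0$ for all $\eta,i$ and $\varepsilon(\mathbf{1})=1$. A bialgebra $B=\bigoplus_{n\ge 0}B_n$ is graded if $B_kB_l\subseteq B_{k+l}$ and $\Delta B_n\subseteq\bigoplus_{k+l=n}B_k\otimes B_l$, and connected if $B_0=\mathbb{R}\mathbf{1}$. *)

theory Defs
  imports "HOL-Analysis.Linear_Algebra" "HOL-Library.Poly_Mapping"
begin

section \<open>Finitely supported functions as real vector spaces and algebras\<close>

instantiation poly_mapping :: (type, real_vector) real_vector
begin

lift_definition scaleR_poly_mapping :: "real \<Rightarrow> ('a \<Rightarrow>\<^sub>0 'b) \<Rightarrow> 'a \<Rightarrow>\<^sub>0 'b"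
  is "\<lambda>r f k. r *\<^sub>R f k"
proof -
  fix r :: real and f :: "'a \<Rightarrow> 'b"
  assume "finite {k. f k \<noteq> 0}"
  then show "finite {k. r *\<^sub>R f k \<noteq> 0}"
    by (rule rev_finite_subset) auto
qed

instance
  by standard (transfer; simp add: fun_eq_iff scaleR_add_right scaleR_add_left)+

end

lemma lookup_scaleR [simp]:
  "Poly_Mapping.lookup (r *\<^sub>R f) k = r *\<^sub>R Poly_Mapping.lookup f k"
  by transfer simp

lemma scaleR_single: "r *\<^sub>R Poly_Mapping.single k v = Poly_Mapping.single k (r *\<^sub>R v)"
  by (rule poly_mapping_eqI) (simp add: lookup_single when_def)

lemma poly_mapping_induct_single:
  assumes "\<And>k v. P (Poly_Mapping.single k v)" "\<And>f g. P f \<Longrightarrow> P g \<Longrightarrow> P (f + g)"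
  shows "P (f :: 'a \<Rightarrow>\<^sub>0 'b::comm_monoid_add)"
proof (induction f rule: update_induct)
  case const
  show ?case using assms(1)[of undefined 0] by simp
next
  case (update f a b)
  have "Poly_Mapping.update a b f = f + Poly_Mapping.single a b"
    using update(1)
    by (intro poly_mapping_eqI)
       (auto simp: lookup_update lookup_add lookup_single when_def in_keys_iff)
  then show ?case using update assms by simp
qed

instance poly_mapping :: (monoid_add, real_algebra_1) real_algebra_1
proof
  fix r :: real and x y :: "'a \<Rightarrow>\<^sub>0 'b"
  show "r *\<^sub>R x * y = r *\<^sub>R (x * y)"
  proof (induction x rule: poly_mapping_induct_single)
    case (1 k v)
    show ?case
      by (induction y rule: poly_mapping_induct_single)
         (simp_all add: scaleR_single mult_single scaleR_add_right distrib_left)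
  qed (simp add: scaleR_add_right distrib_right)
  show "x * r *\<^sub>R y = r *\<^sub>R (x * y)"
  proof (induction x rule: poly_mapping_induct_single)
    case (1 k v)
    show ?case
      by (induction y rule: poly_mapping_induct_single)
         (simp_all add: scaleR_single mult_single scaleR_add_right distrib_left)
  qed (simp add: scaleR_add_right distrib_right)
qed


section \<open>Tensor products of real vector spaces\<close>

text \<open>The free vector space on pairs modulo the bilinearity relations.\<close>

definition tensor_relators :: "(('a::real_vector \<times> 'b::real_vector) \<Rightarrow>\<^sub>0 real) set" where
  "tensor_relators =
     {Poly_Mapping.single (a + a', b) 1 - Poly_Mapping.single (a, b) 1
        - Poly_Mapping.single (a', b) 1 | a a' b. True} \<union>
     {Poly_Mapping.single (a, b + b') 1 - Poly_Mapping.single (a, b) 1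
        - Poly_Mapping.single (a, b') 1 | a b b'. True} \<union>
     {Poly_Mapping.single (r *\<^sub>R a, b) 1 - r *\<^sub>R Poly_Mapping.single (a, b) 1 | r a b. True} \<union>
     {Poly_Mapping.single (a, r *\<^sub>R b) 1 - r *\<^sub>R Poly_Mapping.single (a, b) 1 | r a b. True}"

definition tensor_rel ::
    "(('a::real_vector \<times> 'b::real_vector) \<Rightarrow>\<^sub>0 real) \<Rightarrow> (('a \<times> 'b) \<Rightarrow>\<^sub>0 real) \<Rightarrow> bool" where
  "tensor_rel f g \<longleftrightarrow> f - g \<in> span tensor_relators"

lemma equivp_tensor_rel: "equivp tensor_rel"
proof (rule equivpI)
  show "reflp tensor_rel"
    by (auto simp: reflp_def tensor_rel_def span_zero)
  show "symp tensor_rel"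
    unfolding symp_def tensor_rel_def by (metis minus_diff_eq span_neg)
  show "transp tensor_rel"
    unfolding transp_def tensor_rel_def
    by (metis (no_types, lifting) diff_add_cancel add_diff_eq span_add)
qed

quotient_type (overloaded) ('a, 'b) tensor (infixr "\<otimes>" 71) =
    "('a::real_vector \<times> 'b::real_vector) \<Rightarrow>\<^sub>0 real" / tensor_rel
  by (rule equivp_tensor_rel)

instantiation tensor :: (real_vector, real_vector) real_vector
begin

lift_definition zero_tensor :: "'a \<otimes> 'b" is 0 .

lift_definition plus_tensor :: "'a \<otimes> 'b \<Rightarrow> 'a \<otimes> 'b \<Rightarrow> 'a \<otimes> 'b" is "(+)"
  unfolding tensor_rel_def by (metis add_diff_add span_add)

lift_definition uminus_tensor :: "'a \<otimes> 'b \<Rightarrow> 'a \<otimes> 'b" is uminus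
  unfolding tensor_rel_def by (metis minus_diff_minus span_neg)

lift_definition minus_tensor :: "'a \<otimes> 'b \<Rightarrow> 'a \<otimes> 'b \<Rightarrow> 'a \<otimes> 'b" is "(-)"
proof -
  fix f f' g g' :: "'a \<times> 'b \<Rightarrow>\<^sub>0 real"
  assume "tensor_rel f f'" "tensor_rel g g'"
  then have "(f - f') - (g - g') \<in> span tensor_relators"
    unfolding tensor_rel_def by (rule span_diff)
  then show "tensor_rel (f - g) (f' - g')"
    unfolding tensor_rel_def by (simp add: algebra_simps)
qed

lift_definition scaleR_tensor :: "real \<Rightarrow> 'a \<otimes> 'b \<Rightarrow> 'a \<otimes> 'b" is scaleR
  unfolding tensor_rel_def by (metis scaleR_diff_right span_scale)

instance
  by standard
    (transfer; simp add: tensor_rel_def span_zero scaleR_add_right scaleR_add_left add.assoc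
        add.commute add.left_commute)+

end

lift_definition pure_tensor :: "'a::real_vector \<Rightarrow> 'b::real_vector \<Rightarrow> 'a \<otimes> 'b" (infixr "\<otimes>" 71)
  is "\<lambda>a b. Poly_Mapping.single (a, b) 1" .

lemma bilinear_pure_tensor: "bilinear (pure_tensor :: 'a::real_vector \<Rightarrow> 'b::real_vector \<Rightarrow> 'a \<otimes> 'b)"
proof -
  have rel: "f \<in> tensor_relators \<Longrightarrow> f \<in> span tensor_relators" for f :: "('a \<times> 'b) \<Rightarrow>\<^sub>0 real"
    by (rule span_base)
  have "(a + a') \<otimes> b = a \<otimes> b + a' \<otimes> b" for a a' :: 'a and b :: 'b
    by transfer (unfold tensor_rel_def diff_diff_add[symmetric], rule rel,
        unfold tensor_relators_def, blast)
  moreover have "a \<otimes> (b + b') = a \<otimes> b + a \<otimes> b'" for a :: 'a and b b' :: 'b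
    by transfer (unfold tensor_rel_def diff_diff_add[symmetric], rule rel,
        unfold tensor_relators_def, blast)
  moreover have "(r *\<^sub>R a) \<otimes> b = r *\<^sub>R (a \<otimes> b)" for r and a :: 'a and b :: 'b
    by transfer (unfold tensor_rel_def, rule rel, unfold tensor_relators_def, blast)
  moreover have "a \<otimes> (r *\<^sub>R b) = r *\<^sub>R (a \<otimes> b)" for r and a :: 'a and b :: 'b
    by transfer (unfold tensor_rel_def, rule rel, unfold tensor_relators_def, blast)
  ultimately show ?thesis
    by (auto simp: bilinear_def intro!: linearI)
qed

lemmas pure_tensor_add_left = bilinear_ladd[OF bilinear_pure_tensor]
  and pure_tensor_add_right = bilinear_radd[OF bilinear_pure_tensor]
  and pure_tensor_scaleR_left = bilinear_lmul[OF bilinear_pure_tensor]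
  and pure_tensor_scaleR_right = bilinear_rmul[OF bilinear_pure_tensor]

lemma tensor_induct [case_names pure add]:
  assumes pure: "\<And>a b. P (a \<otimes> b)" and add: "\<And>s t. P s \<Longrightarrow> P t \<Longrightarrow> P (s + t)"
  shows "P (t :: 'a::real_vector \<otimes> 'b::real_vector)"
proof -
  have "P (abs_tensor f)" for f :: "('a \<times> 'b) \<Rightarrow>\<^sub>0 real"
  proof (induction f rule: poly_mapping_induct_single)
    case (1 k v)
    obtain a b where k: "k = (a, b)" by (cases k)
    have "abs_tensor (Poly_Mapping.single k v) = v *\<^sub>R (a \<otimes> b)"
      by (simp add: k pure_tensor.abs_eq scaleR_tensor.abs_eq scaleR_single)
    also have "\<dots> = (v *\<^sub>R a) \<otimes> b"
      by (simp add: pure_tensor_scaleR_left)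
    finally show ?case using pure by simp
  next
    case (2 f g)
    then show ?case using add by (simp add: plus_tensor.abs_eq[symmetric])
  qed
  then show ?thesis by (induction t rule: tensor.abs_induct)
qed

definition free_extension ::
    "('a \<Rightarrow> 'b \<Rightarrow> 'c::real_vector) \<Rightarrow> (('a \<times> 'b) \<Rightarrow>\<^sub>0 real) \<Rightarrow> 'c" where
  "free_extension B f = (\<Sum>(a, b)\<in>Poly_Mapping.keys f. Poly_Mapping.lookup f (a, b) *\<^sub>R B a b)"

lemma free_extension_superset:
  assumes "finite S" "Poly_Mapping.keys f \<subseteq> S"
  shows "free_extension B f = (\<Sum>(a, b)\<in>S. Poly_Mapping.lookup f (a, b) *\<^sub>R B a b)"
  unfolding free_extension_def using assms
  by (intro sum.mono_neutral_left) (auto simp: in_keys_iff)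

lemma linear_free_extension: "linear (free_extension B)"
proof (rule linearI)
  fix f g :: "('a \<times> 'b) \<Rightarrow>\<^sub>0 real" and r :: real
  let ?S = "Poly_Mapping.keys f \<union> Poly_Mapping.keys g"
  have "free_extension B (f + g) =
      (\<Sum>(a, b)\<in>?S. Poly_Mapping.lookup (f + g) (a, b) *\<^sub>R B a b)"
    by (rule free_extension_superset) (use Poly_Mapping.keys_add[of f g] in auto)
  moreover have "free_extension B f = (\<Sum>(a, b)\<in>?S. Poly_Mapping.lookup f (a, b) *\<^sub>R B a b)"
    by (rule free_extension_superset) auto
  moreover have "free_extension B g = (\<Sum>(a, b)\<in>?S. Poly_Mapping.lookup g (a, b) *\<^sub>R B a b)"
    by (rule free_extension_superset) auto
  ultimately show "free_extension B (f + g) = free_extension B f + free_extension B g"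
    by (simp add: lookup_add scaleR_add_left sum.distrib split_def)
  have "free_extension B (r *\<^sub>R f) =
      (\<Sum>(a, b)\<in>Poly_Mapping.keys f. Poly_Mapping.lookup (r *\<^sub>R f) (a, b) *\<^sub>R B a b)"
    by (rule free_extension_superset) (auto simp: in_keys_iff)
  then show "free_extension B (r *\<^sub>R f) = r *\<^sub>R free_extension B f"
    by (simp add: free_extension_def scaleR_sum_right split_def)
qed

lemma free_extension_single [simp]:
  "free_extension B (Poly_Mapping.single (a, b) v) = v *\<^sub>R B a b"
  by (simp add: free_extension_def)

lemma free_extension_relators:
  assumes "bilinear B" "f \<in> span tensor_relators"
  shows "free_extension B f = 0"
  using assms(2)
proof (induction rule: span_induct)
  case base
  show ?case by (simp add: linear_subspace_kernel linear_free_extension)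
next
  case (step f)
  interpret linear "free_extension B" by (rule linear_free_extension)
  show ?case using step bilinear_ladd[OF assms(1)] bilinear_radd[OF assms(1)]
      bilinear_lmul[OF assms(1)] bilinear_rmul[OF assms(1)]
    by (auto simp: tensor_relators_def diff scale)
qed

text \<open>The linear map induced by a bilinear one; it is set to \<open>0\<close> on maps that are not bilinear.\<close>

lift_definition tensor_lift ::
    "('a::real_vector \<Rightarrow> 'b::real_vector \<Rightarrow> 'c::real_vector) \<Rightarrow> 'a \<otimes> 'b \<Rightarrow> 'c"
  is "\<lambda>B f. if bilinear B then free_extension B f else 0"
proof -
  fix B :: "'a \<Rightarrow> 'b \<Rightarrow> 'c" and f g :: "('a \<times> 'b) \<Rightarrow>\<^sub>0 real"
  assume "tensor_rel f g"
  then have "free_extension B (f - g) = 0" if "bilinear B"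
    using that free_extension_relators by (auto simp: tensor_rel_def)
  then show "(if bilinear B then free_extension B f else 0) =
      (if bilinear B then free_extension B g else 0)"
    by (simp add: linear_diff[OF linear_free_extension])
qed

lemma linear_tensor_lift: "linear (tensor_lift B)"
  by (rule linearI; transfer; simp add: linear_add[OF linear_free_extension]
      linear_scale[OF linear_free_extension])

lemma tensor_lift_pure [simp]: "bilinear B \<Longrightarrow> tensor_lift B (a \<otimes> b) = B a b"
  by transfer simp

lemma tensor_universal_property:
  assumes "bilinear B"
  shows "\<exists>!L. linear L \<and> (\<forall>a b. L (a \<otimes> b) = B a b)"
proof (rule ex1I[of _ "tensor_lift B"])
  show "linear (tensor_lift B) \<and> (\<forall>a b. tensor_lift B (a \<otimes> b) = B a b)"
    using assms by (simp add: linear_tensor_lift)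
  fix L assume L: "linear L \<and> (\<forall>a b. L (a \<otimes> b) = B a b)"
  have "L t = tensor_lift B t" for t
    by (induction t rule: tensor_induct)
       (use L assms in \<open>simp_all add: linear_add linear_tensor_lift\<close>)
  then show "L = tensor_lift B" by auto
qed

definition tensor_map ::
    "('a::real_vector \<Rightarrow> 'c::real_vector) \<Rightarrow> ('b::real_vector \<Rightarrow> 'd::real_vector)
       \<Rightarrow> 'a \<otimes> 'b \<Rightarrow> 'c \<otimes> 'd" where
  "tensor_map f g = tensor_lift (\<lambda>a b. f a \<otimes> g b)"

lemma bilinear_tensor_map:
  assumes "linear f" "linear g"
  shows "bilinear (\<lambda>a b. f a \<otimes> g b)"
  using assms by (auto simp: bilinear_def linear_add linear_scale pure_tensor_add_left
      pure_tensor_add_right pure_tensor_scaleR_left pure_tensor_scaleR_right intro!: linearI)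

lemma linear_tensor_map: "linear (tensor_map f g)"
  unfolding tensor_map_def by (rule linear_tensor_lift)

lemma tensor_map_pure [simp]:
  "linear f \<Longrightarrow> linear g \<Longrightarrow> tensor_map f g (a \<otimes> b) = f a \<otimes> g b"
  by (simp add: tensor_map_def bilinear_tensor_map)

definition tensor_assoc ::
    "('a::real_vector \<otimes> 'b::real_vector) \<otimes> 'c::real_vector \<Rightarrow> 'a \<otimes> ('b \<otimes> 'c)" where
  "tensor_assoc = tensor_lift (\<lambda>s c. tensor_lift (\<lambda>a b. a \<otimes> (b \<otimes> c)) s)"

lemma bilinear_tensor_lift_param:
  assumes "\<And>c. bilinear (B c)" "\<And>a b. linear (\<lambda>c. B c a b)"
  shows "bilinear (\<lambda>c t. tensor_lift (B c) t)"
proof -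
  have lift_pure: "tensor_lift (B c) (a \<otimes> b) = B c a b" for c a b
    by (rule tensor_lift_pure[OF assms(1)])
  have "tensor_lift (B (c + c')) t = tensor_lift (B c) t + tensor_lift (B c') t" for c c' t
  proof (induction t rule: tensor_induct)
    case (pure a b)
    show ?case unfolding lift_pure by (rule linear_add[OF assms(2)])
  next
    case (add s t)
    show ?case unfolding linear_add[OF linear_tensor_lift] add by simp
  qed
  moreover have "tensor_lift (B (r *\<^sub>R c)) t = r *\<^sub>R tensor_lift (B c) t" for r c t
  proof (induction t rule: tensor_induct)
    case (pure a b)
    show ?case unfolding lift_pure by (rule linear_scale[OF assms(2)])
  next
    case (add s t)
    show ?case unfolding linear_add[OF linear_tensor_lift] add by (simp add: scaleR_add_right)
  qed
  ultimately show ?thesis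
    by (auto simp: bilinear_def linear_tensor_lift intro!: linearI)
qed

lemma bilinear_swap: "bilinear (\<lambda>a b. B b a) \<longleftrightarrow> bilinear B"
  by (auto simp: bilinear_def)

lemma bilinear_linear_right: "bilinear B \<Longrightarrow> linear (B x)"
  by (simp add: bilinear_def)

lemma tensor_assoc_pure [simp]:
  fixes a :: "'a::real_vector" and b :: "'b::real_vector" and c :: "'c::real_vector"
  shows "tensor_assoc ((a \<otimes> b) \<otimes> c) = a \<otimes> (b \<otimes> c)"
proof -
  have 1: "bilinear (\<lambda>(a::'a) (b::'b). a \<otimes> (b \<otimes> c))" for c :: 'c
    by (auto simp: bilinear_def pure_tensor_add_left pure_tensor_add_right
        pure_tensor_scaleR_left pure_tensor_scaleR_right intro!: linearI)
  have "bilinear (\<lambda>(c::'c) s. tensor_lift (\<lambda>(a::'a) (b::'b). a \<otimes> (b \<otimes> c)) s)"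
    by (rule bilinear_tensor_lift_param[where B = "\<lambda>(c::'c) (a::'a) (b::'b). a \<otimes> (b \<otimes> c)", OF 1])
       (auto simp: pure_tensor_add_right pure_tensor_scaleR_right intro!: linearI)
  then have "bilinear (\<lambda>s (c::'c). tensor_lift (\<lambda>(a::'a) (b::'b). a \<otimes> (b \<otimes> c)) s)"
    by (subst bilinear_swap[symmetric])
  then show ?thesis by (simp add: tensor_assoc_def 1)
qed


section \<open>The tensor product of two algebras\<close>

instantiation tensor :: (real_algebra_1, real_algebra_1) real_algebra_1
begin

definition one_tensor :: "'a \<otimes> 'b" where
  "one_tensor = 1 \<otimes> 1"

definition times_tensor :: "'a \<otimes> 'b \<Rightarrow> 'a \<otimes> 'b \<Rightarrow> 'a \<otimes> 'b" where
  "times_tensor s t = tensor_lift (\<lambda>a b. tensor_lift (\<lambda>a' b'. (a * a') \<otimes> (b * b')) t) s"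

lemma bilinear_times_tensor: "bilinear ((*) :: 'a \<otimes> 'b \<Rightarrow> _)"
  and pure_times_pure: "(a \<otimes> b) * (a' \<otimes> b') = (a * a') \<otimes> (b * b')"
    for a a' :: 'a and b b' :: 'b
proof -
  have 1: "bilinear (\<lambda>a' b'. (a * a') \<otimes> (b * b'))" for a :: 'a and b :: 'b
    by (auto simp: bilinear_def pure_tensor_add_left pure_tensor_add_right distrib_left
        pure_tensor_scaleR_left pure_tensor_scaleR_right intro!: linearI)
  have 2: "bilinear (\<lambda>(a::'a) t. tensor_lift (\<lambda>a' b'. (a * a') \<otimes> (b * b')) t)" for b :: 'b
    by (rule bilinear_tensor_lift_param[where B = "\<lambda>(a::'a) a' b'. (a * a') \<otimes> (b * b')", OF 1])
       (auto simp: pure_tensor_add_left distrib_right pure_tensor_scaleR_left intro!: linearI)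
  have 3: "bilinear (\<lambda>(b::'b) t. tensor_lift (\<lambda>a' b'. (a * a') \<otimes> (b * b')) t)" for a :: 'a
    by (rule bilinear_tensor_lift_param[where B = "\<lambda>(b::'b) a' b'. (a * a') \<otimes> (b * b')", OF 1])
       (auto simp: pure_tensor_add_right distrib_right pure_tensor_scaleR_right intro!: linearI)
  have 4: "bilinear (\<lambda>(a::'a) (b::'b). tensor_lift (\<lambda>a' b'. (a * a') \<otimes> (b * b')) t)" for t :: "'a \<otimes> 'b"
    using 2 3 by (simp add: bilinear_def)
  have 5: "bilinear (\<lambda>t s. tensor_lift
      (\<lambda>(a::'a) (b::'b). tensor_lift (\<lambda>a' b'. (a * a') \<otimes> (b * b')) t) s)"
    by (rule bilinear_tensor_lift_param[
          where B = "\<lambda>t (a::'a) (b::'b). tensor_lift (\<lambda>a' b'. (a * a') \<otimes> (b * b')) t", OF 4]) (rule linear_tensor_lift)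
  have "bilinear (\<lambda>t s. s * t :: 'a \<otimes> 'b)"
    unfolding times_tensor_def by (rule 5)
  then show "bilinear ((*) :: 'a \<otimes> 'b \<Rightarrow> _)"
    by (subst bilinear_swap[symmetric])
  show "(a \<otimes> b) * (a' \<otimes> b') = (a * a') \<otimes> (b * b')" for a a' :: 'a and b b' :: 'b
    by (simp only: times_tensor_def, subst tensor_lift_pure[OF 4], rule tensor_lift_pure[OF 1])
qed

instance
proof
  fix r :: real and s t u :: "'a \<otimes> 'b"
  note add = bilinear_ladd[OF bilinear_times_tensor] bilinear_radd[OF bilinear_times_tensor]
  show "(s + t) * u = s * u + t * u" "s * (t + u) = s * t + s * u"
    by (rule add)+
  show "(r *\<^sub>R s) * t = r *\<^sub>R (s * t)" "s * (r *\<^sub>R t) = r *\<^sub>R (s * t)"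
    by (rule bilinear_lmul[OF bilinear_times_tensor] bilinear_rmul[OF bilinear_times_tensor])+
  show "1 * s = s" "s * 1 = s"
    unfolding one_tensor_def
    by (induction s rule: tensor_induct) (simp_all add: pure_times_pure add)
  have "(s * (a \<otimes> b)) * (a' \<otimes> b') = s * ((a \<otimes> b) * (a' \<otimes> b'))" for a b a' b'
    by (induction s rule: tensor_induct) (simp_all add: pure_times_pure add mult.assoc)
  then have "(s * t) * (a' \<otimes> b') = s * (t * (a' \<otimes> b'))" for a' b'
    by (induction t rule: tensor_induct) (simp_all add: add)
  then show "(s * t) * u = s * (t * u)"
    by (induction u rule: tensor_induct) (simp_all add: add)
  show "(0 :: 'a \<otimes> 'b) \<noteq> 1"
  proof
    assume 0: "(0 :: 'a \<otimes> 'b) = 1"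
    have "independent {1::'a}" "independent {1::'b}" by simp_all
    then obtain f :: "'a \<Rightarrow> real" and g :: "'b \<Rightarrow> real"
      where fg: "linear f" "f 1 = 1" "linear g" "g 1 = 1"
      using linear_independent_extend[of "{1::'a}" "\<lambda>_. 1::real"]
        linear_independent_extend[of "{1::'b}" "\<lambda>_. 1::real"] by auto
    then have B: "bilinear (\<lambda>a b. f a * g b)"
      by (auto simp: bilinear_def linear_add linear_scale algebra_simps intro!: linearI)
    have "tensor_lift (\<lambda>a b. f a * g b) (1 \<otimes> 1) = 1"
      using B fg by simp
    moreover have "tensor_lift (\<lambda>a b. f a * g b) 0 = 0"
      by (rule linear_0[OF linear_tensor_lift])
    ultimately show False using 0 by (simp add: one_tensor_def)
  qed
qed

end


section \<open>Hopf algebras\<close>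

definition unital_algebra_hom :: "('a::real_algebra_1 \<Rightarrow> 'b::real_algebra_1) \<Rightarrow> bool" where
  "unital_algebra_hom f \<longleftrightarrow> linear f \<and> f 1 = 1 \<and> (\<forall>x y. f (x * y) = f x * f y)"

text \<open>Associativity and unitality of the product are part of the class \<open>real_algebra_1\<close>.\<close>

locale bialgebra =
  fixes \<Delta> :: "'h::real_algebra_1 \<Rightarrow> 'h \<otimes> 'h" and \<epsilon> :: "'h \<Rightarrow> real"
  assumes hom_coproduct: "unital_algebra_hom \<Delta>"
    and hom_counit: "unital_algebra_hom \<epsilon>"
    and coassociative: "tensor_assoc (tensor_map \<Delta> id (\<Delta> h)) = tensor_map id \<Delta> (\<Delta> h)"
    and counit_left: "tensor_lift (\<lambda>r x. r *\<^sub>R x) (tensor_map \<epsilon> id (\<Delta> h)) = h"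
    and counit_right: "tensor_lift (\<lambda>x r. r *\<^sub>R x) (tensor_map id \<epsilon> (\<Delta> h)) = h"

locale hopf_algebra = bialgebra +
  assumes antipode: "\<exists>S. linear S \<and>
    (\<forall>h. tensor_lift (*) (tensor_map S id (\<Delta> h)) = \<epsilon> h *\<^sub>R 1 \<and>
         tensor_lift (*) (tensor_map id S (\<Delta> h)) = \<epsilon> h *\<^sub>R 1)"

definition direct_sum_decomposition :: "(nat \<Rightarrow> 'a::real_vector set) \<Rightarrow> bool" where
  "direct_sum_decomposition B \<longleftrightarrow> (\<forall>n. subspace (B n)) \<and>
     (\<forall>x. \<exists>!f. (\<forall>n. f n \<in> B n) \<and> finite {n. f n \<noteq> 0} \<and> x = Sum_any f)"

locale graded_bialgebra = bialgebra \<Delta> \<epsilon>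
  for \<Delta> :: "'h::real_algebra_1 \<Rightarrow> 'h \<otimes> 'h" and \<epsilon> :: "'h \<Rightarrow> real" +
  fixes B :: "nat \<Rightarrow> 'h set"
  assumes direct_sum: "direct_sum_decomposition B"
    and graded_mult: "x \<in> B k \<Longrightarrow> y \<in> B l \<Longrightarrow> x * y \<in> B (k + l)"
    and graded_coproduct:
      "x \<in> B n \<Longrightarrow> \<Delta> x \<in> span {a \<otimes> b | a b k l. k + l = n \<and> a \<in> B k \<and> b \<in> B l}"

locale connected_graded_commutative_hopf_algebra =
  hopf_algebra \<Delta> \<epsilon> + graded_bialgebra \<Delta> \<epsilon> B
  for \<Delta> :: "'h::real_algebra_1 \<Rightarrow> 'h \<otimes> 'h" and \<epsilon> :: "'h \<Rightarrow> real" and B :: "nat \<Rightarrow> 'h set" +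
  assumes connected: "B 0 = range (\<lambda>r. r *\<^sub>R 1)"
    and commutative: "(x::'h) * y = y * x"


section \<open>Formal power series in noncommuting letters\<close>

text \<open>
  A series is its coefficient function on words. Infinite sums of series are taken coefficientwise;
  all those below have only finitely many nonzero terms in each coefficient, so that \<open>Sum_any\<close>
  (which is \<open>0\<close> on infinite supports) is the intended sum.
\<close>

type_synonym 'x series = "'x list \<Rightarrow> real"

definition one_series :: "'x series" where
  "one_series \<zeta> = (if \<zeta> = [] then 1 else 0)"

text \<open>Left concatenation \<open>e \<mapsto> x e\<close> with a letter.\<close>

definition lcons :: "'x \<Rightarrow> 'x series \<Rightarrow> 'x series" where
  "lcons x e \<zeta> = (case \<zeta> of [] \<Rightarrow> 0 | y # \<zeta>' \<Rightarrow> if y = x then e \<zeta>' else 0)"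

fun shuffle_word :: "'x list \<Rightarrow> 'x list \<Rightarrow> 'x series" where
  "shuffle_word [] \<xi> = (\<lambda>\<zeta>. if \<zeta> = \<xi> then 1 else 0)"
| "shuffle_word \<eta> [] = (\<lambda>\<zeta>. if \<zeta> = \<eta> then 1 else 0)"
| "shuffle_word (x # \<eta>) (y # \<xi>) =
     (\<lambda>\<zeta>. lcons x (shuffle_word \<eta> (y # \<xi>)) \<zeta> + lcons y (shuffle_word (x # \<eta>) \<xi>) \<zeta>)"

definition shuffle :: "'x series \<Rightarrow> 'x series \<Rightarrow> 'x series" where
  "shuffle c d \<zeta> = Sum_any (\<lambda>(\<eta>, \<xi>). c \<eta> * d \<xi> * shuffle_word \<eta> \<xi> \<zeta>)"

lemma shuffle_word_nonzero:
  "shuffle_word \<eta> \<xi> \<zeta> \<noteq> 0 \<Longrightarrow>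
     length \<eta> + length \<xi> = length \<zeta> \<and> set \<eta> \<union> set \<xi> \<subseteq> set \<zeta>"
  by (induction \<eta> \<xi> arbitrary: \<zeta> rule: shuffle_word.induct)
     (force simp: lcons_def split: if_splits list.splits)+

lemma finite_shuffle_support:
  "finite {(\<eta>, \<xi>). c \<eta> * d \<xi> * shuffle_word \<eta> \<xi> \<zeta> \<noteq> 0}"
proof (rule finite_subset)
  let ?W = "{\<eta>. set \<eta> \<subseteq> set \<zeta> \<and> length \<eta> \<le> length \<zeta>}"
  show "{(\<eta>, \<xi>). c \<eta> * d \<xi> * shuffle_word \<eta> \<xi> \<zeta> \<noteq> 0} \<subseteq> ?W \<times> ?W"
    using shuffle_word_nonzero by fastforce
  show "finite (?W \<times> ?W)"
    by (intro finite_cartesian_product finite_lists_length_le) auto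
qed

text \<open>
  The indices \<open>1, \<dots>, m\<close> form the finite type \<open>'m\<close>; the alphabet is \<open>'m option\<close>, where
  \<open>None\<close> is \<open>x\<^sub>0\<close> and \<open>Some i\<close> is \<open>x\<^sub>i\<close>. A series with vector coefficients is given by its
  components.
\<close>

definition letter_map ::
    "('m \<Rightarrow> 'm option series) \<Rightarrow> 'm option \<Rightarrow> 'm option series \<Rightarrow> 'm option series" where
  "letter_map d x e \<zeta> =
     lcons x e \<zeta> + lcons None (shuffle (case x of None \<Rightarrow> (\<lambda>_. 0) | Some i \<Rightarrow> d i) e) \<zeta>"

primrec word_map ::
    "('m \<Rightarrow> 'm option series) \<Rightarrow> 'm option list \<Rightarrow> 'm option series \<Rightarrow> 'm option series" where
  "word_map d [] = id"
| "word_map d (x # \<eta>) = letter_map d x \<circ> word_map d \<eta>"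

definition modified_composition ::
    "('l \<Rightarrow> 'm option series) \<Rightarrow> ('m \<Rightarrow> 'm option series) \<Rightarrow> 'l \<Rightarrow> 'm option series" where
  "modified_composition c d i \<xi> = Sum_any (\<lambda>\<eta>. c i \<eta> * word_map d \<eta> one_series \<xi>)"

definition composition_group_product ::
    "('m \<Rightarrow> 'm option series) \<Rightarrow> ('m \<Rightarrow> 'm option series) \<Rightarrow> 'm \<Rightarrow> 'm option series"
    (infixl "\<circledcirc>" 70) where
  "(c \<circledcirc> d) i \<xi> = d i \<xi> + modified_composition c d i \<xi>"

lemma shuffle_nonzero:
  assumes "shuffle c e \<zeta> \<noteq> 0"
  shows "\<exists>\<xi>. e \<xi> \<noteq> 0 \<and> length \<xi> \<le> length \<zeta>"
proof -
  obtain \<eta> \<xi> where "c \<eta> * e \<xi> * shuffle_word \<eta> \<xi> \<zeta> \<noteq> 0"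
    using assms unfolding shuffle_def
    by (metis (no_types, lifting) Sum_any.not_neutral_obtains_not_neutral case_prod_beta)
  then show ?thesis using shuffle_word_nonzero[of \<eta> \<xi> \<zeta>] by auto
qed

lemma word_map_nonzero:
  "word_map d \<eta> e \<zeta> \<noteq> 0 \<Longrightarrow> length \<eta> \<le> length \<zeta>"
proof -
  have "word_map d \<eta> e \<zeta> \<noteq> 0 \<Longrightarrow> \<exists>\<xi>. e \<xi> \<noteq> 0 \<and> length \<eta> + length \<xi> \<le> length \<zeta>" for \<zeta>
  proof (induction \<eta> arbitrary: \<zeta>)
    case (Cons x \<eta>)
    then obtain y \<zeta>' where \<zeta>: "\<zeta> = y # \<zeta>'"
      by (cases \<zeta>) (auto simp: letter_map_def lcons_def)
    have "\<exists>\<zeta>''. word_map d \<eta> e \<zeta>'' \<noteq> 0 \<and> length \<zeta>'' \<le> length \<zeta>'"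
    proof (cases "word_map d \<eta> e \<zeta>' = 0")
      case True
      then have "\<exists>c. shuffle c (word_map d \<eta> e) \<zeta>' \<noteq> 0"
        using Cons.prems by (auto simp: letter_map_def lcons_def \<zeta> split: if_splits)
      then show ?thesis using shuffle_nonzero by blast
    qed auto
    with Cons.IH \<zeta> show ?case by fastforce
  qed auto
  then show "word_map d \<eta> e \<zeta> \<noteq> 0 \<Longrightarrow> length \<eta> \<le> length \<zeta>" by fastforce
qed

lemma finite_modified_composition_support:
  fixes c :: "'l \<Rightarrow> 'm::finite option series"
  shows "finite {\<eta>. c i \<eta> * word_map d \<eta> one_series \<xi> \<noteq> 0}"
proof (rule finite_subset)
  show "{\<eta>. c i \<eta> * word_map d \<eta> one_series \<xi> \<noteq> 0} \<subseteq>
      {\<eta>. set \<eta> \<subseteq> UNIV \<and> length \<eta> \<le> length \<xi>}"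
    using word_map_nonzero by fastforce
qed (rule finite_lists_length_le[OF finite_UNIV])


section \<open>The algebra of coordinate functions\<close>

text \<open>
  Real polynomials in the indeterminates \<open>(i, \<eta>)\<close>: finitely supported functions on the monomials,
  which in turn are finitely supported exponent functions.
\<close>

type_synonym 'm coord_monomial = "('m \<times> 'm option list) \<Rightarrow>\<^sub>0 nat"
type_synonym 'm coord_algebra = "'m coord_monomial \<Rightarrow>\<^sub>0 real"

definition coordinate :: "'m \<Rightarrow> 'm option list \<Rightarrow> 'm coord_algebra" where
  "coordinate i \<eta> = Poly_Mapping.single (Poly_Mapping.single (i, \<eta>) 1) 1"

definition coordinate_degree :: "'m::finite \<Rightarrow> 'm option list \<Rightarrow> nat" where
  "coordinate_degree i \<eta> =
     2 * count_list \<eta> None + (\<Sum>j\<in>UNIV. count_list \<eta> (Some j)) + 1"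

definition monomial_degree :: "'m::finite coord_monomial \<Rightarrow> nat" where
  "monomial_degree M =
     (\<Sum>(i, \<eta>)\<in>Poly_Mapping.keys M. Poly_Mapping.lookup M (i, \<eta>) * coordinate_degree i \<eta>)"

definition coord_component :: "nat \<Rightarrow> 'm::finite coord_algebra set" where
  "coord_component n = span {Poly_Mapping.single M 1 | M. monomial_degree M = n}"

definition coord_eval :: "'m coord_algebra \<Rightarrow> ('m \<Rightarrow> 'm option series) \<Rightarrow> real" where
  "coord_eval p c =
     (\<Sum>M\<in>Poly_Mapping.keys p. Poly_Mapping.lookup p M *
        (\<Prod>(i, \<eta>)\<in>Poly_Mapping.keys M. c i \<eta> ^ Poly_Mapping.lookup M (i, \<eta>)))"

lemma coord_eval_coordinate: "coord_eval (coordinate i \<eta>) c = c i \<eta>"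
  by (simp add: coord_eval_def coordinate_def)

lemma linear_coord_eval: "linear (\<lambda>p. coord_eval p c)"
proof -
  let ?w = "\<lambda>M. \<Prod>(i, \<eta>)\<in>Poly_Mapping.keys M. c i \<eta> ^ Poly_Mapping.lookup M (i, \<eta>)"
  have eval: "coord_eval p c = (\<Sum>M\<in>S. Poly_Mapping.lookup p M * ?w M)"
    if "finite S" "Poly_Mapping.keys p \<subseteq> S" for p S
    unfolding coord_eval_def using that
    by (intro sum.mono_neutral_left) (auto simp: in_keys_iff)
  show ?thesis
  proof (rule linearI)
    fix p q :: "'a coord_algebra" and r :: real
    let ?S = "Poly_Mapping.keys p \<union> Poly_Mapping.keys q"
    have "Poly_Mapping.keys (p + q) \<subseteq> ?S" by (rule Poly_Mapping.keys_add)
    then show "coord_eval (p + q) c = coord_eval p c + coord_eval q c"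
      by (simp add: eval[of ?S] lookup_add distrib_right sum.distrib)
    have "Poly_Mapping.keys (r *\<^sub>R p) \<subseteq> Poly_Mapping.keys p" by (auto simp: in_keys_iff)
    then show "coord_eval (r *\<^sub>R p) c = r *\<^sub>R coord_eval p c"
      by (simp add: eval[of "Poly_Mapping.keys p"] sum_distrib_left mult.assoc)
  qed
qed

definition coord_eval2 ::
    "'m coord_algebra \<otimes> 'm coord_algebra
       \<Rightarrow> ('m \<Rightarrow> 'm option series) \<Rightarrow> ('m \<Rightarrow> 'm option series) \<Rightarrow> real" where
  "coord_eval2 t c d = tensor_lift (\<lambda>f g. coord_eval f c * coord_eval g d) t"

lemma coord_eval2_pure: "coord_eval2 (f \<otimes> g) c d = coord_eval f c * coord_eval g d"
proof -
  have "bilinear (\<lambda>f g. coord_eval f c * coord_eval g d)"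
    by (auto simp: bilinear_def linear_add[OF linear_coord_eval] linear_scale[OF linear_coord_eval]
        algebra_simps intro!: linearI)
  then show ?thesis by (simp add: coord_eval2_def)
qed

definition is_coproduct ::
    "('m::finite coord_algebra \<Rightarrow> 'm coord_algebra \<otimes> 'm coord_algebra) \<Rightarrow> bool" where
  "is_coproduct \<Delta> \<longleftrightarrow> unital_algebra_hom \<Delta> \<and>
     (\<forall>i \<eta> c d. coord_eval2 (\<Delta> (coordinate i \<eta>)) c d = (c \<circledcirc> d) i \<eta>)"

definition is_counit :: "('m::finite coord_algebra \<Rightarrow> real) \<Rightarrow> bool" where
  "is_counit \<epsilon> \<longleftrightarrow> unital_algebra_hom \<epsilon> \<and> (\<forall>i \<eta>. \<epsilon> (coordinate i \<eta>) = 0)"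

end

theory Submission
  imports Defs
begin

text \<open>
  A polynomial in \<open>H\<close>, or a tensor in \<open>H \<otimes> H\<close>, is determined by its values on (pairs of) series.
  Under evaluation the coproduct becomes \<open>f(c \<circledcirc> d)\<close> and the counit \<open>f(0)\<close>, so the bialgebra axioms
  say that \<open>\<circledcirc>\<close> is associative with neutral element \<open>0\<close>. Both the shuffle product and the modified
  composition product obey a recursion on the word through left derivatives, from which associativity
  follows by induction on the length; the same recursion shows that \<open>(c \<circledcirc> d)\<^sub>i\<close> has homogeneous
  polynomial coefficients. The antipode of a connected graded bialgebra is the locally finite
  series \<open>\<Sum>\<^sub>n (-1)\<^sup>n J\<^sup>n\<close> of convolution powers of \<open>J = id - \<eta>\<epsilon>\<close>.
\<close>

section \<open>Shuffle product and left derivatives\<close>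

text \<open>Tensors have no normal form here: \<open>is_coproduct\<close> prescribes only the values
  of \<Delta> on pairs of series, and coassociativity is an equation in H \<otimes> (H \<otimes> H).
  So existence and uniqueness of a tensor with given values both need proof. Uniqueness comes from
  separation by evaluations. Existence comes together with the grading: the induction that makes the
  coefficients of a component of c \<circledcirc> d polynomial also tracks the degree of a
  representing tensor.

  The degree is dictated by \<phi>_d(x_i)(e) = x_i e + x_0 (d_i shuffle e). The second summand
  trades a letter x_i of weight 1 for x_0 and a coordinate of d_i, whose degree exceeds the weight
  of its word by 1; weight 2 for x_0 balances this. That extra 1 also gives every coordinate
  positive degree, so H_0 consists of scalars and the antipode series terminates on each element.
  The antipode is thus obtained without constructing inverses for \<circledcirc>.\<close>

definition lderiv :: "'x \<Rightarrow> 'x series \<Rightarrow> 'x series" where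
  "lderiv x c = (\<lambda>\<eta>. c (x # \<eta>))"

lemma lcons_Nil [simp]: "lcons x e [] = 0"
  by (simp add: lcons_def)

lemma lcons_Cons: "lcons x e (y # \<zeta>) = (if y = x then e \<zeta> else 0)"
  by (simp add: lcons_def)

lemma lderiv_add: "lderiv x (\<lambda>\<eta>. c \<eta> + d \<eta>) = (\<lambda>\<eta>. lderiv x c \<eta> + lderiv x d \<eta>)"
  by (simp add: lderiv_def)

lemma shuffle_word_Nil_right: "shuffle_word \<eta> [] \<zeta> = (if \<zeta> = \<eta> then 1 else 0)"
  by (cases \<eta>) auto

text \<open>The first letter of a shuffle is the first letter of one of the two factors. Reading the
  recursion from the side of the result is what produces left derivatives.\<close>

lemma shuffle_word_Cons:
  "shuffle_word \<eta> \<xi> (z # \<zeta>) =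
     (case \<eta> of [] \<Rightarrow> 0 | x # \<eta>' \<Rightarrow> if x = z then shuffle_word \<eta>' \<xi> \<zeta> else 0) +
     (case \<xi> of [] \<Rightarrow> 0 | y # \<xi>' \<Rightarrow> if y = z then shuffle_word \<eta> \<xi>' \<zeta> else 0)"
  by (cases "(\<eta>, \<xi>)" rule: shuffle_word.cases)
     (auto simp: lcons_Cons shuffle_word_Nil_right split: list.splits)

text \<open>Contains every factor that can contribute to the coefficient at \<zeta>. The alphabet
  may be infinite, so a bound on the length alone would not give a finite set.\<close>

definition words_over :: "'x list \<Rightarrow> 'x list set" where
  "words_over \<zeta> = {\<eta>. set \<eta> \<subseteq> set \<zeta> \<and> length \<eta> \<le> length \<zeta>}"

lemma finite_words_over: "finite (words_over \<zeta>)"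
  unfolding words_over_def by (intro finite_lists_length_le) auto

lemma shuffle_eq_sum:
  assumes "finite A" "finite B" "words_over \<zeta> \<subseteq> A" "words_over \<zeta> \<subseteq> B"
  shows "shuffle c d \<zeta> = (\<Sum>\<eta>\<in>A. \<Sum>\<xi>\<in>B. c \<eta> * d \<xi> * shuffle_word \<eta> \<xi> \<zeta>)"
proof -
  have "shuffle c d \<zeta> = (\<Sum>(\<eta>, \<xi>)\<in>A \<times> B. c \<eta> * d \<xi> * shuffle_word \<eta> \<xi> \<zeta>)"
    unfolding shuffle_def
  proof (rule Sum_any.expand_superset)
    have "\<eta> \<in> A \<and> \<xi> \<in> B" if "shuffle_word \<eta> \<xi> \<zeta> \<noteq> 0" for \<eta> \<xi>
      using shuffle_word_nonzero[OF that] assms(3,4) by (auto simp: words_over_def subset_eq)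
    then show "{a. (case a of (\<eta>, \<xi>) \<Rightarrow> c \<eta> * d \<xi> * shuffle_word \<eta> \<xi> \<zeta>) \<noteq> 0} \<subseteq> A \<times> B"
      by auto
  qed (use assms in simp)
  then show ?thesis by (simp add: sum.cartesian_product)
qed

text \<open>The last hypothesis serves words \<open>z # \<eta>\<close> over
  \<open>z # \<zeta>\<close> whose tail still uses \<open>z\<close> although \<zeta> does
  not.\<close>

lemma sum_case_Cons:
  assumes "finite A" "finite B" "Cons z ` B \<subseteq> A"
    and "\<And>\<eta>. z # \<eta> \<in> A \<Longrightarrow> \<eta> \<notin> B \<Longrightarrow> f (z # \<eta>) \<eta> = 0"
  shows "(\<Sum>\<eta>\<in>A. case \<eta> of [] \<Rightarrow> 0 | x # \<eta>' \<Rightarrow> if x = z then f \<eta> \<eta>' else 0) =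
    (\<Sum>\<eta>\<in>B. f (z # \<eta>) \<eta> :: real)"
proof -
  let ?g = "\<lambda>\<eta>. case \<eta> of [] \<Rightarrow> 0 | x # \<eta>' \<Rightarrow> if x = z then f \<eta> \<eta>' else 0"
  have "sum ?g A = sum ?g (Cons z ` B)"
    using assms by (intro sum.mono_neutral_right) (auto split: list.splits)
  also have "\<dots> = (\<Sum>\<eta>\<in>B. f (z # \<eta>) \<eta>)"
    by (subst sum.reindex) auto
  finally show ?thesis .
qed

lemma shuffle_Nil: "shuffle c d [] = c [] * d []"
  by (subst shuffle_eq_sum[of "{[]}" "{[]}"]) (auto simp: words_over_def)

text \<open>Left derivatives are derivations of the shuffle product; together with \<open>shuffle_Nil\<close>
  this recursion on the word replaces the infinite sum in all later proofs.\<close>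

lemma shuffle_Cons:
  "shuffle c d (z # \<zeta>) = shuffle (lderiv z c) d \<zeta> + shuffle c (lderiv z d) \<zeta>"
proof -
  let ?A = "words_over (z # \<zeta>)" and ?B = "words_over \<zeta>"
  have sub: "?B \<subseteq> ?A" "Cons z ` ?B \<subseteq> ?A" by (auto simp: words_over_def)
  have nz: "shuffle_word \<eta> \<xi> \<zeta> = 0" if "\<eta> \<notin> ?B \<or> \<xi> \<notin> ?B" for \<eta> \<xi>
    using that shuffle_word_nonzero[of \<eta> \<xi> \<zeta>]
    by (cases "shuffle_word \<eta> \<xi> \<zeta> = 0") (auto simp: words_over_def)
  have "shuffle c d (z # \<zeta>) = (\<Sum>\<eta>\<in>?A. \<Sum>\<xi>\<in>?A. c \<eta> * d \<xi> * shuffle_word \<eta> \<xi> (z # \<zeta>))"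
    by (intro shuffle_eq_sum finite_words_over) auto
  also have "\<dots> =
      (\<Sum>\<xi>\<in>?A. \<Sum>\<eta>\<in>?A. case \<eta> of [] \<Rightarrow> 0
         | x # \<eta>' \<Rightarrow> if x = z then c \<eta> * d \<xi> * shuffle_word \<eta>' \<xi> \<zeta> else 0) +
      (\<Sum>\<eta>\<in>?A. \<Sum>\<xi>\<in>?A. case \<xi> of [] \<Rightarrow> 0
         | y # \<xi>' \<Rightarrow> if y = z then c \<eta> * d \<xi> * shuffle_word \<eta> \<xi>' \<zeta> else 0)"
    unfolding shuffle_word_Cons distrib_left sum.distrib
    by (intro arg_cong2[where f = "(+)"], subst sum.swap)
       (auto intro!: sum.cong split: list.splits)
  also have "\<dots> =
      (\<Sum>\<xi>\<in>?A. \<Sum>\<eta>\<in>?B. c (z # \<eta>) * d \<xi> * shuffle_word \<eta> \<xi> \<zeta>) +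
      (\<Sum>\<eta>\<in>?A. \<Sum>\<xi>\<in>?B. c \<eta> * d (z # \<xi>) * shuffle_word \<eta> \<xi> \<zeta>)"
    using sub by (intro arg_cong2[where f = "(+)"] sum.cong refl sum_case_Cons)
      (auto simp: nz finite_words_over)
  also have "\<dots> = shuffle (lderiv z c) d \<zeta> + shuffle c (lderiv z d) \<zeta>"
    using sub
    by (subst sum.swap, subst (1 2) shuffle_eq_sum[of _ _ \<zeta>])
       (auto simp: finite_words_over lderiv_def)
  finally show ?thesis .
qed

lemma lderiv_shuffle:
  "lderiv z (shuffle c d) = (\<lambda>\<zeta>. shuffle (lderiv z c) d \<zeta> + shuffle c (lderiv z d) \<zeta>)"
  by (simp add: lderiv_def fun_eq_iff shuffle_Cons)

lemma shuffle_commute: "shuffle c d = shuffle d c"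
proof
  show "shuffle c d \<zeta> = shuffle d c \<zeta>" for \<zeta>
    by (induction \<zeta> arbitrary: c d) (auto simp: shuffle_Nil shuffle_Cons)
qed

lemma shuffle_add_left: "shuffle (\<lambda>\<eta>. c \<eta> + c' \<eta>) d \<zeta> = shuffle c d \<zeta> + shuffle c' d \<zeta>"
  by (induction \<zeta> arbitrary: c c' d)
     (auto simp: shuffle_Nil shuffle_Cons lderiv_add distrib_right)

lemma shuffle_scale_left: "shuffle (\<lambda>\<eta>. r * c \<eta>) d \<zeta> = r * shuffle c d \<zeta>"
  by (induction \<zeta> arbitrary: c d)
     (auto simp: shuffle_Nil shuffle_Cons lderiv_def distrib_left)

lemma shuffle_add_right: "shuffle c (\<lambda>\<eta>. d \<eta> + d' \<eta>) \<zeta> = shuffle c d \<zeta> + shuffle c d' \<zeta>"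
  unfolding shuffle_commute[of c] by (rule shuffle_add_left)

lemma shuffle_scale_right: "shuffle c (\<lambda>\<eta>. r * d \<eta>) \<zeta> = r * shuffle c d \<zeta>"
  unfolding shuffle_commute[of c] by (rule shuffle_scale_left)

lemma shuffle_zero_left [simp]: "shuffle (\<lambda>_. 0) d \<zeta> = 0"
  using shuffle_scale_left[of 0 "\<lambda>_. 0" d \<zeta>] by simp

lemma shuffle_zero_right [simp]: "shuffle c (\<lambda>_. 0) \<zeta> = 0"
  using shuffle_scale_right[of c 0 "\<lambda>_. 0" \<zeta>] by simp

lemma shuffle_sum_right:
  "shuffle c (\<lambda>\<eta>. \<Sum>i\<in>I. d i \<eta>) \<zeta> = (\<Sum>i\<in>I. shuffle c (d i) \<zeta>)"
  by (induction I rule: infinite_finite_induct) (auto simp: shuffle_add_right)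

lemma shuffle_sum_left:
  "shuffle (\<lambda>\<eta>. \<Sum>i\<in>I. c i \<eta>) d \<zeta> = (\<Sum>i\<in>I. shuffle (c i) d \<zeta>)"
  by (induction I rule: infinite_finite_induct) (auto simp: shuffle_add_left)

lemma shuffle_assoc: "shuffle (shuffle a b) c = shuffle a (shuffle b c)"
proof
  show "shuffle (shuffle a b) c \<zeta> = shuffle a (shuffle b c) \<zeta>" for \<zeta>
    by (induction \<zeta> arbitrary: a b c)
       (auto simp: shuffle_Nil shuffle_Cons lderiv_shuffle shuffle_add_left shuffle_add_right)
qed

lemma shuffle_left_commute: "shuffle a (shuffle b c) = shuffle b (shuffle a c)"
  unfolding shuffle_assoc[symmetric] shuffle_commute[of a b] ..

text \<open>Lets an induction hypothesis that is known only for short words be applied inside a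
  shuffle product.\<close>

lemma shuffle_cong:
  assumes "\<And>\<eta>. length \<eta> \<le> length \<zeta> \<Longrightarrow> c \<eta> = c' \<eta>"
    and "\<And>\<eta>. length \<eta> \<le> length \<zeta> \<Longrightarrow> d \<eta> = d' \<eta>"
  shows "shuffle c d \<zeta> = shuffle c' d' \<zeta>"
  using assms
proof (induction \<zeta> arbitrary: c d c' d')
  case Nil
  then show ?case by (simp add: shuffle_Nil)
next
  case (Cons z \<zeta>)
  have "shuffle (lderiv z c) d \<zeta> = shuffle (lderiv z c') d' \<zeta>"
    "shuffle c (lderiv z d) \<zeta> = shuffle c' (lderiv z d') \<zeta>"
    by (rule Cons.IH; simp add: lderiv_def Cons.prems)+
  then show ?case by (simp add: shuffle_Cons)
qed

section \<open>The modified composition product\<close>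

text \<open>The modified composition for one scalar component. Since \<open>word_map\<close> never
  shortens a word and the alphabet is finite, the cutoff by length loses nothing and leaves a finite
  sum.\<close>

definition compose :: "'m option series \<Rightarrow> ('m::finite \<Rightarrow> 'm option series) \<Rightarrow> 'm option series" where
  "compose a d \<xi> = (\<Sum>\<eta> | length \<eta> \<le> length \<xi>. a \<eta> * word_map d \<eta> one_series \<xi>)"

lemma finite_words_length: "finite {\<eta> :: 'a::finite list. length \<eta> \<le> n}"
  using finite_lists_length_le[of "UNIV :: 'a set" n] by simp

lemma compose_eq_sum:
  assumes "length \<xi> \<le> n"
  shows "compose a d \<xi> = (\<Sum>\<eta> | length \<eta> \<le> n. a \<eta> * word_map d \<eta> one_series \<xi>)"
  unfolding compose_def
  using assms word_map_nonzero[of d _ one_series \<xi>]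
  by (intro sum.mono_neutral_left finite_words_length) auto

lemma modified_composition_eq_compose:
  "modified_composition c d i = compose (c i) (d :: 'm::finite \<Rightarrow> _)"
proof
  fix \<xi>
  show "modified_composition c d i \<xi> = compose (c i) d \<xi>"
    unfolding modified_composition_def compose_def
    by (rule Sum_any.expand_superset[OF finite_words_length])
       (use word_map_nonzero in fastforce)
qed

lemma words_length_Suc:
  "{\<eta> :: 'a list. length \<eta> \<le> Suc n} =
     insert [] ((\<lambda>(x, \<eta>). x # \<eta>) ` (UNIV \<times> {\<eta>. length \<eta> \<le> n}))" (is "_ = ?R")
proof -
  have "\<eta> \<in> ?R \<longleftrightarrow> length \<eta> \<le> Suc n" for \<eta>
    by (cases \<eta>) auto
  then show ?thesis by blast
qed

lemma sum_words_length_Suc: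
  "(\<Sum>\<eta> | length \<eta> \<le> Suc n. f \<eta> :: real) =
     f [] + (\<Sum>x\<in>UNIV. \<Sum>\<eta> | length \<eta> \<le> n. f ((x :: 'a::finite) # \<eta>))"
  unfolding words_length_Suc
  by (subst sum.insert)
     (auto simp: finite_words_length sum.reindex inj_on_def split_def sum.cartesian_product)

lemma compose_Nil: "compose a d [] = a []"
  by (simp add: compose_def one_series_def)

lemma sum_UNIV_option:
  "(\<Sum>x\<in>UNIV. f x) = f None + (\<Sum>i\<in>UNIV. f (Some (i :: 'a::finite)))"
  by (simp add: UNIV_option_conv sum.reindex)

text \<open>The derivative of \<open>\<phi>\<^sub>d(x)(e)\<close> along \<open>x\<close> is \<open>e\<close>, and along \<open>x\<^sub>0\<close> there is
  the additional term \<open>d\<^sub>x\<close> shuffled with \<open>e\<close>.\<close>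

lemma compose_Cons:
  "compose a d (y # \<xi>) = compose (lderiv y a) d \<xi> +
     (if y = None then \<Sum>i\<in>UNIV. shuffle (d i) (compose (lderiv (Some i) a) d) \<xi> else 0)"
proof -
  let ?W = "\<lambda>\<eta>. word_map d \<eta> one_series"
  let ?L = "{\<eta> :: 'a option list. length \<eta> \<le> length \<xi>}"
  let ?d = "\<lambda>x. case x of None \<Rightarrow> (\<lambda>_. 0) | Some i \<Rightarrow> d i"
  have sh: "(\<Sum>\<eta>\<in>?L. a (x # \<eta>) * shuffle (?d x) (?W \<eta>) \<xi>) =
      shuffle (?d x) (compose (lderiv x a) d) \<xi>" for x
  proof -
    have "(\<Sum>\<eta>\<in>?L. a (x # \<eta>) * shuffle (?d x) (?W \<eta>) \<xi>) =
        shuffle (?d x) (\<lambda>\<zeta>. \<Sum>\<eta>\<in>?L. a (x # \<eta>) * ?W \<eta> \<zeta>) \<xi>"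
      by (simp add: shuffle_sum_right shuffle_scale_right)
    \<comment> \<open>\<open>compose\<close> cuts off at the length of its own argument, the sum at
      that of \<xi>. They agree on words no longer than \<xi>, which are all that the coefficient at
      \<xi> sees.\<close>
    also have "\<dots> = shuffle (?d x) (compose (lderiv x a) d) \<xi>"
      by (rule shuffle_cong) (auto simp: compose_eq_sum[where n = "length \<xi>"] lderiv_def)
    finally show ?thesis .
  qed
  have "compose a d (y # \<xi>) = (\<Sum>x\<in>UNIV. \<Sum>\<eta>\<in>?L. a (x # \<eta>) * ?W (x # \<eta>) (y # \<xi>))"
    by (simp add: compose_def sum_words_length_Suc one_series_def)
  also have "\<dots> = (\<Sum>x\<in>UNIV. (if x = y then \<Sum>\<eta>\<in>?L. a (x # \<eta>) * ?W \<eta> \<xi> else 0) +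
      (if y = None then \<Sum>\<eta>\<in>?L. a (x # \<eta>) * shuffle (?d x) (?W \<eta>) \<xi> else 0))"
    by (intro sum.cong refl)
       (auto simp: letter_map_def lcons_Cons distrib_left sum.distrib)
  also have "\<dots> = compose (lderiv y a) d \<xi> +
      (if y = None then \<Sum>x\<in>UNIV. shuffle (?d x) (compose (lderiv x a) d) \<xi> else 0)"
    by (cases y) (simp_all add: sum.distrib sh, simp_all add: compose_def lderiv_def)
  also have "(\<Sum>x\<in>UNIV. shuffle (?d x) (compose (lderiv x a) d) \<xi>) =
      (\<Sum>i\<in>UNIV. shuffle (d i) (compose (lderiv (Some i) a) d) \<xi>)"
    by (simp add: sum_UNIV_option)
  finally show ?thesis .
qed

lemma lderiv_compose:
  "lderiv y (compose a d) = (\<lambda>\<xi>. compose (lderiv y a) d \<xi> +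
     (if y = None then \<Sum>i\<in>UNIV. shuffle (d i) (compose (lderiv (Some i) a) d) \<xi> else 0))"
  by (simp add: lderiv_def[of y "compose a d"] compose_Cons)

lemma compose_add: "compose (\<lambda>\<eta>. a \<eta> + b \<eta>) d = (\<lambda>\<xi>. compose a d \<xi> + compose b d \<xi>)"
  by (simp add: compose_def distrib_right sum.distrib fun_eq_iff)

lemma compose_sum: "compose (\<lambda>\<eta>. \<Sum>i\<in>I. a i \<eta>) d = (\<lambda>\<xi>. \<Sum>i\<in>I. compose (a i) d \<xi>)"
  by (rule ext) (simp add: compose_def sum_distrib_right, rule sum.swap)

lemma compose_zero [simp]: "compose (\<lambda>_. 0) d = (\<lambda>_. 0)"
  by (simp add: compose_def fun_eq_iff)

lemma compose_zero_right: "compose a (\<lambda>_ _. 0) = a"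
proof
  show "compose a (\<lambda>_ _. 0) \<xi> = a \<xi>" for \<xi>
    by (induction \<xi> arbitrary: a) (auto simp: compose_Nil compose_Cons lderiv_def)
qed

text \<open>The map that sends a to the derivative of \<open>compose a e\<close> along any letter
  obeys the Leibniz rule: \<open>lderiv\<close> does, and each factor \<open>e i\<close> can be
  moved past \<open>compose a e\<close> by commutativity. Both sides therefore satisfy the same
  recursion.\<close>

lemma compose_shuffle: "compose (shuffle a b) e = shuffle (compose a e) (compose b e)"
proof
  fix \<xi>
  show "compose (shuffle a b) e \<xi> = shuffle (compose a e) (compose b e) \<xi>"
  \<comment> \<open>Structural induction would be too weak: the x_0-term is a shuffle product, so
    \<open>shuffle_cong\<close> asks for the claim at all words no longer than the tail.\<close>
  proof (induction \<xi> arbitrary: a b rule: measure_induct_rule[of length])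
    case (less \<xi>)
    show ?case
    proof (cases \<xi>)
      case Nil
      then show ?thesis by (simp add: compose_Nil shuffle_Nil)
    next
      case (Cons y \<xi>')
      let ?c = "\<lambda>a. compose a e" and ?D = "\<lambda>i. lderiv (Some i)"
      have IH: "?c (shuffle a b) \<zeta> = shuffle (?c a) (?c b) \<zeta>" if "length \<zeta> \<le> length \<xi>'" for \<zeta> a b
        using less that Cons by simp
      have "shuffle (e i) (?c (lderiv (Some i) (shuffle a b))) \<xi>' =
          shuffle (shuffle (e i) (?c (?D i a))) (?c b) \<xi>' +
          shuffle (?c a) (shuffle (e i) (?c (?D i b))) \<xi>'" for i
      proof -
        have "shuffle (e i) (?c (lderiv (Some i) (shuffle a b))) \<xi>' =
            shuffle (e i) (\<lambda>\<zeta>. shuffle (?c (?D i a)) (?c b) \<zeta> + shuffle (?c a) (?c (?D i b)) \<zeta>) \<xi>'"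
          by (rule shuffle_cong) (auto simp: lderiv_shuffle compose_add IH)
        moreover have "shuffle (e i) (shuffle (?c a) (?c (?D i b))) =
            shuffle (?c a) (shuffle (e i) (?c (?D i b)))"
          by (rule shuffle_left_commute)
        ultimately show ?thesis by (simp add: shuffle_add_right shuffle_assoc)
      qed
      then show ?thesis
        by (cases y) (simp_all add: Cons compose_Cons shuffle_Cons lderiv_shuffle compose_add IH lderiv_compose
            shuffle_add_left shuffle_add_right shuffle_sum_left shuffle_sum_right sum.distrib)
    qed
  qed
qed

lemma composition_group_product_eq: "(c \<circledcirc> d) i = (\<lambda>\<xi>. d i \<xi> + compose (c i) d \<xi>)"
  by (simp add: composition_group_product_def modified_composition_eq_compose fun_eq_iff)

text \<open>Along x_0 there are two correction terms: the inner one, shuffled with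
  \<open>d i\<close>, becomes a shuffle with \<open>compose (d i) e\<close> by
  \<open>compose_shuffle\<close>, and the outer one is shuffled with \<open>e i\<close>. Their sum
  is a shuffle with \<open>(d \<circledcirc> e) i\<close>, which is why the group product adds d to
  the composition.\<close>

lemma compose_compose: "compose (compose a d) e = compose a (d \<circledcirc> e)"
proof
  fix \<xi>
  show "compose (compose a d) e \<xi> = compose a (d \<circledcirc> e) \<xi>"
  proof (induction \<xi> arbitrary: a rule: measure_induct_rule[of length])
    case (less \<xi>)
    show ?case
    proof (cases \<xi>)
      case Nil
      then show ?thesis by (simp add: compose_Nil)
    next
      case (Cons y \<xi>')
      have IH: "compose (compose a d) e \<zeta> = compose a (d \<circledcirc> e) \<zeta>"
        if "length \<zeta> \<le> length \<xi>'" for \<zeta> a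
        using less that Cons by simp
      have "shuffle (compose (d i) e) (compose (compose (lderiv (Some i) a) d) e) \<xi>' +
          shuffle (e i) (compose (compose (lderiv (Some i) a) d) e) \<xi>' =
          shuffle ((d \<circledcirc> e) i) (compose (lderiv (Some i) a) (d \<circledcirc> e)) \<xi>'" for i
        unfolding composition_group_product_eq shuffle_add_left
        by (subst add.commute, intro arg_cong2[where f = "(+)"] shuffle_cong)
           (auto simp: IH simp flip: composition_group_product_eq)
      then show ?thesis
        by (cases y) (simp_all add: Cons compose_Cons[of "compose a d"] compose_Cons[of a] lderiv_compose
            compose_add compose_sum compose_shuffle IH flip: sum.distrib)
    qed
  qed
qed

lemma composition_group_product_assoc:
  "(c \<circledcirc> d) \<circledcirc> e = c \<circledcirc> (d \<circledcirc> (e :: 'm::finite \<Rightarrow> 'm option series))"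
  by (rule ext) (simp add: composition_group_product_eq compose_add compose_compose add.assoc)

lemma zero_composition_group_product: "(\<lambda>_ _. 0) \<circledcirc> d = (d :: 'm::finite \<Rightarrow> 'm option series)"
  by (rule ext) (simp add: composition_group_product_eq)

lemma composition_group_product_zero: "c \<circledcirc> (\<lambda>_ _. 0) = (c :: 'm::finite \<Rightarrow> 'm option series)"
  by (rule ext) (simp add: composition_group_product_eq compose_zero_right)

section \<open>Connected graded bialgebras have an antipode\<close>

text \<open>The antipode axiom asks for a two-sided inverse of \<open>id\<close> under this product,
  whose neutral element is \<open>\<lambda>h. \<epsilon> h *\<^sub>R 1\<close>.\<close>

definition (in bialgebra) convolution :: "('h \<Rightarrow> 'h) \<Rightarrow> ('h \<Rightarrow> 'h) \<Rightarrow> 'h \<Rightarrow> 'h" where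
  "convolution f g h = tensor_lift (*) (tensor_map f g (\<Delta> h))"

text \<open>Explains the form of many identities below: \<Delta> h is in general not a pure tensor,
  so they are stated as equalities of functions of an arbitrary tensor and specialised to \<Delta> h
  afterwards.\<close>

lemma tensor_linear_eqI:
  assumes "linear L" "linear L'" "\<And>a b. L (a \<otimes> b) = L' (a \<otimes> b)"
  shows "L = L'"
proof
  show "L t = L' t" for t
    by (induction t rule: tensor_induct) (use assms in \<open>simp_all add: linear_add\<close>)
qed

lemma linear_tensor_assoc: "linear tensor_assoc"
  unfolding tensor_assoc_def by (rule linear_tensor_lift)

lemmas linear_tensor_compose =
  linear_compose[OF linear_tensor_map linear_tensor_lift, unfolded o_def]

lemma tensor_lift_mult_pure [simp]: "tensor_lift (*) (a \<otimes> b) = (a * b :: 'a::real_algebra)"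
  by (simp add: bilinear_times)

lemma (in bialgebra) linear_coproduct: "linear \<Delta>"
  using hom_coproduct by (simp add: unital_algebra_hom_def)

lemma (in bialgebra) linear_counit: "linear \<epsilon>"
  using hom_counit by (simp add: unital_algebra_hom_def)

lemma (in bialgebra) linear_convolution: "linear (convolution f g)"
  unfolding convolution_def
  using linear_compose[OF linear_coproduct linear_tensor_compose] by (simp add: o_def)

lemma tensor_lift_add_map_left:
  fixes f g k :: "'a::real_algebra_1 \<Rightarrow> 'a"
  assumes "linear f" "linear g" "linear k"
  shows "(\<lambda>t. tensor_lift (*) (tensor_map (\<lambda>x. f x + g x) k t)) =
    (\<lambda>t. tensor_lift (*) (tensor_map f k t) + tensor_lift (*) (tensor_map g k t))"
  by (rule tensor_linear_eqI)
     (use assms in \<open>simp_all add: linear_tensor_compose linear_compose_add distrib_right\<close>)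

lemma tensor_lift_add_map_right:
  fixes f g k :: "'a::real_algebra_1 \<Rightarrow> 'a"
  assumes "linear f" "linear g" "linear k"
  shows "(\<lambda>t. tensor_lift (*) (tensor_map k (\<lambda>x. f x + g x) t)) =
    (\<lambda>t. tensor_lift (*) (tensor_map k f t) + tensor_lift (*) (tensor_map k g t))"
  by (rule tensor_linear_eqI)
     (use assms in \<open>simp_all add: linear_tensor_compose linear_compose_add distrib_left\<close>)

lemma tensor_lift_scale_map_left:
  fixes f k :: "'a::real_algebra_1 \<Rightarrow> 'a"
  assumes "linear f" "linear k"
  shows "(\<lambda>t. tensor_lift (*) (tensor_map (\<lambda>x. r *\<^sub>R f x) k t)) =
    (\<lambda>t. r *\<^sub>R tensor_lift (*) (tensor_map f k t))"
  by (rule tensor_linear_eqI)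
     (use assms in \<open>simp_all add: linear_tensor_compose linear_compose_scale_right\<close>)

lemma tensor_lift_scale_map_right:
  fixes f k :: "'a::real_algebra_1 \<Rightarrow> 'a"
  assumes "linear f" "linear k"
  shows "(\<lambda>t. tensor_lift (*) (tensor_map k (\<lambda>x. r *\<^sub>R f x) t)) =
    (\<lambda>t. r *\<^sub>R tensor_lift (*) (tensor_map k f t))"
  by (rule tensor_linear_eqI)
     (use assms in \<open>simp_all add: linear_tensor_compose linear_compose_scale_right\<close>)

lemma (in bialgebra) convolution_add_left:
  "linear f \<Longrightarrow> linear g \<Longrightarrow> linear k \<Longrightarrow>
     convolution (\<lambda>x. f x + g x) k h = convolution f k h + convolution g k h"
  by (simp add: convolution_def fun_cong[OF tensor_lift_add_map_left])

lemma (in bialgebra) convolution_add_right: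
  "linear f \<Longrightarrow> linear g \<Longrightarrow> linear k \<Longrightarrow>
     convolution k (\<lambda>x. f x + g x) h = convolution k f h + convolution k g h"
  by (simp add: convolution_def fun_cong[OF tensor_lift_add_map_right])

lemma (in bialgebra) convolution_scale_left:
  "linear f \<Longrightarrow> linear k \<Longrightarrow> convolution (\<lambda>x. r *\<^sub>R f x) k h = r *\<^sub>R convolution f k h"
  by (simp add: convolution_def fun_cong[OF tensor_lift_scale_map_left])

lemma (in bialgebra) convolution_scale_right:
  "linear f \<Longrightarrow> linear k \<Longrightarrow> convolution k (\<lambda>x. r *\<^sub>R f x) h = r *\<^sub>R convolution k f h"
  by (simp add: convolution_def fun_cong[OF tensor_lift_scale_map_right])

text \<open>Both sides come from the single map \<open>tensor_lift B\<close> on H \<otimes> (H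
  \<otimes> H), which multiplies f, g and k of the three factors; it is applied to the two sides of
  coassociativity.\<close>

lemma (in bialgebra) convolution_assoc:
  assumes "linear f" "linear g" "linear k"
  shows "convolution (convolution f g) k h = convolution f (convolution g k) h"
proof -
  define B where "B = (\<lambda>a s. f a * tensor_lift (*) (tensor_map g k s))"
  have B: "bilinear B"
    unfolding B_def bilinear_def
    by (auto intro!: linearI simp: linear_add[OF assms(1)] linear_scale[OF assms(1)]
        linear_add[OF linear_tensor_compose] linear_scale[OF linear_tensor_compose] algebra_simps)
  have inner: "(\<lambda>s. tensor_lift (*) (tensor_map f g s) * k b) =
      (\<lambda>s. tensor_lift B (tensor_assoc (s \<otimes> b)))" for b
  proof (rule tensor_linear_eqI)
    show "linear (\<lambda>s. tensor_lift (*) (tensor_map f g s) * k b)"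
      by (auto intro!: linearI simp: linear_add[OF linear_tensor_compose]
          linear_scale[OF linear_tensor_compose] algebra_simps)
    show "linear (\<lambda>s. tensor_lift B (tensor_assoc (s \<otimes> b)))"
      unfolding tensor_assoc_def
      by (auto intro!: linearI simp: linear_add[OF linear_tensor_lift]
          linear_scale[OF linear_tensor_lift] pure_tensor_add_left pure_tensor_scaleR_left)
    show "tensor_lift (*) (tensor_map f g (a \<otimes> a')) * k b =
        tensor_lift B (tensor_assoc ((a \<otimes> a') \<otimes> b))" for a a'
      using assms B by (simp add: B_def mult.assoc)
  qed
  have "(\<lambda>t. tensor_lift (*) (tensor_map (convolution f g) k t)) =
      (\<lambda>t. tensor_lift B (tensor_assoc (tensor_map \<Delta> id t)))"
  proof (rule tensor_linear_eqI)
    show "linear (\<lambda>t. tensor_lift B (tensor_assoc (tensor_map \<Delta> id t)))"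
      by (rule linear_compose[OF linear_compose[OF linear_tensor_map linear_tensor_assoc]
            linear_tensor_lift, unfolded o_def])
    show "tensor_lift (*) (tensor_map (convolution f g) k (a \<otimes> b)) =
        tensor_lift B (tensor_assoc (tensor_map \<Delta> id (a \<otimes> b)))" for a b
      using assms fun_cong[OF inner, of "\<Delta> a" b]
      by (simp add: linear_convolution linear_coproduct linear_id) (simp add: convolution_def)
  qed (rule linear_tensor_compose)
  moreover have "(\<lambda>t. tensor_lift (*) (tensor_map f (convolution g k) t)) =
      (\<lambda>t. tensor_lift B (tensor_map id \<Delta> t))"
  proof (rule tensor_linear_eqI)
    show "linear (\<lambda>t. tensor_lift B (tensor_map id \<Delta> t))"
      by (rule linear_compose[OF linear_tensor_map linear_tensor_lift, unfolded o_def])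
    show "tensor_lift (*) (tensor_map f (convolution g k) (a \<otimes> b)) =
        tensor_lift B (tensor_map id \<Delta> (a \<otimes> b))" for a b
      using assms B by (simp add: linear_convolution linear_coproduct linear_id)
        (simp add: B_def convolution_def)
  qed (rule linear_tensor_compose)
  ultimately show ?thesis
    by (simp add: convolution_def[of _ _ h] coassociative fun_eq_iff)
qed

lemma (in bialgebra) linear_unit_counit: "linear (\<lambda>h. \<epsilon> h *\<^sub>R 1)"
  by (intro linearI) (simp_all add: linear_add[OF linear_counit] linear_scale[OF linear_counit]
      scaleR_add_left)

lemma bilinear_scaleR_left: "bilinear (\<lambda>r (x :: 'a::real_vector). r *\<^sub>R x)"
  and bilinear_scaleR_right: "bilinear (\<lambda>(x :: 'a::real_vector) r. r *\<^sub>R x)"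
  by (auto simp: bilinear_def algebra_simps intro!: linearI)

lemma (in bialgebra) convolution_unit_left:
  assumes "linear f"
  shows "convolution (\<lambda>h. \<epsilon> h *\<^sub>R 1) f h = f h"
proof -
  have "(\<lambda>t. tensor_lift (*) (tensor_map (\<lambda>h. \<epsilon> h *\<^sub>R 1) f t)) =
      (\<lambda>t. f (tensor_lift (\<lambda>r x. r *\<^sub>R x) (tensor_map \<epsilon> id t)))"
    by (rule tensor_linear_eqI)
       (auto simp: linear_tensor_compose linear_unit_counit linear_counit assms linear_id
          linear_scale[OF assms] bilinear_scaleR_left
          intro: linear_compose[unfolded o_def, OF linear_tensor_compose])
  from fun_cong[OF this] show ?thesis by (simp add: convolution_def counit_left)
qed

lemma (in bialgebra) convolution_unit_right:
  assumes "linear f"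
  shows "convolution f (\<lambda>h. \<epsilon> h *\<^sub>R 1) h = f h"
proof -
  have "(\<lambda>t. tensor_lift (*) (tensor_map f (\<lambda>h. \<epsilon> h *\<^sub>R 1) t)) =
      (\<lambda>t. f (tensor_lift (\<lambda>x r. r *\<^sub>R x) (tensor_map id \<epsilon> t)))"
    by (rule tensor_linear_eqI)
       (auto simp: linear_tensor_compose linear_unit_counit linear_counit assms linear_id
          linear_scale[OF assms] bilinear_scaleR_right
          intro: linear_compose[unfolded o_def, OF linear_tensor_compose])
  from fun_cong[OF this] show ?thesis by (simp add: convolution_def counit_right)
qed

primrec (in bialgebra) reduced_power :: "nat \<Rightarrow> 'h \<Rightarrow> 'h" where
  "reduced_power 0 = (\<lambda>h. \<epsilon> h *\<^sub>R 1)"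
| "reduced_power (Suc n) = convolution (\<lambda>h. h - \<epsilon> h *\<^sub>R 1) (reduced_power n)"

lemma (in bialgebra) linear_reduced_power: "linear (reduced_power n)"
  by (cases n) (simp_all add: linear_unit_counit linear_convolution)

lemma (in bialgebra) linear_reduced: "linear (\<lambda>h. h - \<epsilon> h *\<^sub>R 1)"
  by (intro linear_compose_sub linear_ident linear_unit_counit)

text \<open>The powers of J are built by multiplication from the left. Having them from the right as
  well is what makes one series a two-sided inverse.\<close>

lemma (in bialgebra) reduced_power_commute:
  "convolution (reduced_power n) (\<lambda>h. h - \<epsilon> h *\<^sub>R 1) = reduced_power (Suc n)"
proof (induction n)
  case 0
  show ?case
    by (rule ext) (simp add: convolution_unit_left convolution_unit_right linear_reduced)
next
  case (Suc n)
  let ?J = "\<lambda>h. h - \<epsilon> h *\<^sub>R 1"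
  have "convolution (reduced_power (Suc n)) ?J =
      convolution ?J (convolution (reduced_power n) ?J)"
    by (rule ext) (simp add: convolution_assoc linear_reduced linear_reduced_power)
  also have "\<dots> = reduced_power (Suc (Suc n))"
    by (simp only: Suc reduced_power.simps(2)[of "Suc n"])
  finally show ?case .
qed

text \<open>Convolution distributes over finite sums, so the geometric series is treated by
  truncations; the full series appears only pointwise, in \<open>antipode_exists\<close>.\<close>

definition (in bialgebra) antipode_partial :: "nat \<Rightarrow> 'h \<Rightarrow> 'h" where
  "antipode_partial N h = (\<Sum>n\<le>N. (-1) ^ n *\<^sub>R reduced_power n h)"

lemma (in bialgebra) linear_antipode_partial: "linear (antipode_partial N)"
  unfolding antipode_partial_def
  by (intro linear_compose_sum ballI linear_compose_scale_right linear_reduced_power)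

lemma (in bialgebra) antipode_partial_Suc:
  "antipode_partial (Suc N) =
     (\<lambda>h. antipode_partial N h + (-1) ^ Suc N *\<^sub>R reduced_power (Suc N) h)"
  by (simp add: antipode_partial_def fun_eq_iff del: reduced_power.simps)

text \<open>With \<open>J = id - \<eta>\<epsilon>\<close>, the partial sums of \<open>\<Sum>\<^sub>n (-1)\<^sup>n J\<^sup>n\<close> invert \<open>id = \<eta>\<epsilon> + J\<close> up to a single
  power of \<open>J\<close>.\<close>

lemma (in bialgebra) reduced_antipode_partial:
  shows "convolution (\<lambda>h. h - \<epsilon> h *\<^sub>R 1) (antipode_partial N) h =
      \<epsilon> h *\<^sub>R 1 - antipode_partial N h + (-1) ^ N *\<^sub>R reduced_power (Suc N) h"
    and "convolution (antipode_partial N) (\<lambda>h. h - \<epsilon> h *\<^sub>R 1) h =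
      \<epsilon> h *\<^sub>R 1 - antipode_partial N h + (-1) ^ N *\<^sub>R reduced_power (Suc N) h"
proof (induction N)
  case 0
  have 0: "antipode_partial 0 = reduced_power 0"
    by (simp add: antipode_partial_def fun_eq_iff)
  { case 1 show ?case by (simp add: 0) }
  { case 2 show ?case unfolding 0 reduced_power_commute by simp }
next
  case (Suc N)
  note lin = linear_reduced linear_antipode_partial linear_reduced_power
    linear_compose_scale_right
  { case 1
    have "convolution (\<lambda>h. h - \<epsilon> h *\<^sub>R 1) (reduced_power (Suc N)) = reduced_power (Suc (Suc N))"
      by simp
    then show ?case
      unfolding antipode_partial_Suc
      by (subst convolution_add_right)
         (simp_all add: convolution_scale_right lin Suc.IH(1)
          del: reduced_power.simps power_Suc, simp) }
  { case 2
    show ?case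
      unfolding antipode_partial_Suc
      by (subst convolution_add_left)
         (simp_all add: convolution_scale_left lin Suc.IH(2)
          reduced_power_commute del: reduced_power.simps power_Suc, simp) }
qed

lemma (in bialgebra) convolution_antipode_partial:
  "convolution id (antipode_partial N) h = \<epsilon> h *\<^sub>R 1 + (-1) ^ N *\<^sub>R reduced_power (Suc N) h"
  "convolution (antipode_partial N) id h = \<epsilon> h *\<^sub>R 1 + (-1) ^ N *\<^sub>R reduced_power (Suc N) h"
proof -
  have id: "id = (\<lambda>h. (\<lambda>h. \<epsilon> h *\<^sub>R 1) h + (\<lambda>h. h - \<epsilon> h *\<^sub>R 1) h)" by auto
  note lin = linear_reduced linear_antipode_partial linear_unit_counit
  show "convolution id (antipode_partial N) h = \<epsilon> h *\<^sub>R 1 + (-1) ^ N *\<^sub>R reduced_power (Suc N) h"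
    unfolding id
    by (subst convolution_add_left) (simp_all add: lin convolution_unit_left
        reduced_antipode_partial del: reduced_power.simps)
  show "convolution (antipode_partial N) id h = \<epsilon> h *\<^sub>R 1 + (-1) ^ N *\<^sub>R reduced_power (Suc N) h"
    unfolding id
    by (subst convolution_add_right) (simp_all add: lin convolution_unit_right
        reduced_antipode_partial del: reduced_power.simps)
qed

section \<open>Local finiteness of the antipode series in the connected graded case\<close>

abbreviation graded_tensors :: "(nat \<Rightarrow> 'a::real_vector set) \<Rightarrow> nat \<Rightarrow> ('a \<otimes> 'a) set" where
  "graded_tensors B n \<equiv> span {a \<otimes> b | a b k l. k + l = n \<and> a \<in> B k \<and> b \<in> B l}"

lemma linear_eq_graded_tensors:
  assumes "linear L" "linear L'" "t \<in> graded_tensors B n"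
    and "\<And>a b k l. k + l = n \<Longrightarrow> a \<in> B k \<Longrightarrow> b \<in> B l \<Longrightarrow> L (a \<otimes> b) = L' (a \<otimes> b)"
  shows "L t = L' t"
  by (rule linear_eq_on_span[OF assms(1,2) _ assms(3)]) (use assms(4) in auto)

lemma linear_eq_direct_sum:
  assumes "direct_sum_decomposition B" "linear L" "linear L'"
    and "\<And>n x. x \<in> B n \<Longrightarrow> L x = L' x"
  shows "L x = L' x"
proof -
  obtain f where f: "\<And>n. f n \<in> B n" "finite {n. f n \<noteq> 0}" "x = Sum_any f"
    using assms(1) unfolding direct_sum_decomposition_def by metis
  then have x: "x = sum f {n. f n \<noteq> 0}" by (simp add: Sum_any.expand_set)
  show ?thesis
    unfolding x linear_sum[OF assms(2)] linear_sum[OF assms(3)]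
    by (rule sum.cong[OF refl]) (rule assms(4)[OF f(1)])
qed

text \<open>J kills scalars, hence all of degree 0. Each of the n factors J must thus receive degree
  at least 1, and an element of degree below n cannot supply that.\<close>

lemma (in graded_bialgebra) reduced_power_eq_0:
  assumes "B 0 = range (\<lambda>r. r *\<^sub>R 1)" "x \<in> B k" "k < n"
  shows "reduced_power n x = 0"
  using assms(2,3)
proof (induction n arbitrary: x k)
  case (Suc n)
  let ?J = "\<lambda>h. h - \<epsilon> h *\<^sub>R 1"
  have "?J a * reduced_power n b = 0" if ab: "p + q = k" "a \<in> B p" "b \<in> B q" for a b p q
  proof (cases "p = 0")
    case True
    then obtain r where "a = r *\<^sub>R 1" using ab(2) assms(1) by blast
    moreover have "\<epsilon> (r *\<^sub>R 1) = r"
      using hom_counit by (simp add: unital_algebra_hom_def linear_scale)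
    ultimately show ?thesis by simp
  next
    case False
    then show ?thesis using Suc.IH[of b q] that Suc.prems by simp
  qed
  then have "tensor_lift (*) (tensor_map ?J (reduced_power n) (\<Delta> x)) = 0"
    by (intro linear_eq_graded_tensors[OF linear_tensor_compose _ graded_coproduct[OF Suc.prems(1)],
          where L' = "\<lambda>_. 0"])
       (auto simp: linear_zero linear_reduced linear_reduced_power)
  then show ?case by (simp add: convolution_def)
qed simp

lemma (in graded_bialgebra) antipode_exists:
  assumes "B 0 = range (\<lambda>r. r *\<^sub>R 1)"
  shows "\<exists>S. linear S \<and> (\<forall>h. convolution S id h = \<epsilon> h *\<^sub>R 1 \<and> convolution id S h = \<epsilon> h *\<^sub>R 1)"
proof -
  define S where "S h = Sum_any (\<lambda>n. (-1) ^ n *\<^sub>R reduced_power n h)" for h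
  \<comment> \<open>Keeps \<open>Sum_any\<close> away from its default 0 on infinite supports: an
    element has finitely many homogeneous components, hence a largest degree.\<close>
  have vanish: "\<exists>N. \<forall>n>N. reduced_power n x = 0" for x
  proof -
    obtain f where f: "\<And>n. f n \<in> B n" "finite {n. f n \<noteq> 0}" "x = Sum_any f"
      using direct_sum unfolding direct_sum_decomposition_def by metis
    then have x: "x = sum f {n. f n \<noteq> 0}" by (simp add: Sum_any.expand_set)
    obtain N where N: "\<And>n. f n \<noteq> 0 \<Longrightarrow> n \<le> N"
      using f(2) by (auto simp: finite_nat_set_iff_bounded_le)
    have "reduced_power n x = 0" if "n > N" for n
      unfolding x linear_sum[OF linear_reduced_power]
    proof (rule sum.neutral, rule ballI)
      fix k assume "k \<in> {n. f n \<noteq> 0}"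
      then have "k < n" using N[of k] that by simp
      with f(1) show "reduced_power n (f k) = 0" by (rule reduced_power_eq_0[OF assms])
    qed
    then show ?thesis by blast
  qed
  have S: "S x = antipode_partial N x" if "\<And>n. n > N \<Longrightarrow> reduced_power n x = 0" for x N
    unfolding S_def antipode_partial_def
    by (rule Sum_any.expand_superset) (use that not_le in auto)
  have linear: "linear S"
  proof (rule linearI)
    fix x y and r :: real
    obtain M N where M: "\<And>n. n > M \<Longrightarrow> reduced_power n x = 0"
      and N: "\<And>n. n > N \<Longrightarrow> reduced_power n y = 0"
      using vanish[of x] vanish[of y] by blast
    show "S (x + y) = S x + S y"
      by (subst (1 2 3) S[where N = "max M N"])
         (auto simp: M N linear_add[OF linear_reduced_power] linear_add[OF linear_antipode_partial])
    show "S (r *\<^sub>R x) = r *\<^sub>R S x"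
      by (subst (1 2) S[where N = M])
         (auto simp: M linear_scale[OF linear_reduced_power] linear_scale[OF linear_antipode_partial])
  qed
  have S_B: "S b = antipode_partial n b" if "b \<in> B l" "l \<le> n" for b l n
    using that by (intro S reduced_power_eq_0[OF assms, of b l]) auto
  \<comment> \<open>For x of degree n all tensor factors in \<Delta> x have degree at most n, so the
    one truncation at n replaces S throughout, and the remaining power n + 1 of J vanishes at
    x.\<close>
  have on_B: "convolution S id x = \<epsilon> x *\<^sub>R 1" "convolution id S x = \<epsilon> x *\<^sub>R 1" if "x \<in> B n" for x n
  proof -
    have "convolution S id x = convolution (antipode_partial n) id x"
      unfolding convolution_def
      by (rule linear_eq_graded_tensors[OF linear_tensor_compose linear_tensor_compose
            graded_coproduct[OF that]])
         (simp add: linear linear_id linear_antipode_partial S_B[where n = n])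
    moreover have "convolution id S x = convolution id (antipode_partial n) x"
      unfolding convolution_def
      by (rule linear_eq_graded_tensors[OF linear_tensor_compose linear_tensor_compose
            graded_coproduct[OF that]])
         (simp add: linear linear_id linear_antipode_partial S_B[where n = n])
    ultimately show "convolution S id x = \<epsilon> x *\<^sub>R 1" "convolution id S x = \<epsilon> x *\<^sub>R 1"
      using reduced_power_eq_0[OF assms that, of "Suc n"]
      by (simp_all add: convolution_antipode_partial del: reduced_power.simps)
  qed
  have "convolution S id h = \<epsilon> h *\<^sub>R 1" "convolution id S h = \<epsilon> h *\<^sub>R 1" for h
    by (rule linear_eq_direct_sum[OF direct_sum linear_convolution linear_unit_counit, OF on_B(1)],
        assumption)
       (rule linear_eq_direct_sum[OF direct_sum linear_convolution linear_unit_counit, OF on_B(2)])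
  with linear show ?thesis by blast
qed

lemma (in graded_bialgebra) hopf_algebra_connected:
  assumes "B 0 = range (\<lambda>r. r *\<^sub>R 1)"
  shows "hopf_algebra \<Delta> \<epsilon>"
  by unfold_locales (use antipode_exists[OF assms] in \<open>simp add: convolution_def\<close>)

section \<open>Polynomials as functions\<close>

text \<open>Makes H \<otimes> H an admissible target of \<open>polynomial_value\<close>, by which
  \<Delta> is constructed.\<close>

instance tensor ::
  ("{real_algebra_1, comm_ring_1}", "{real_algebra_1, comm_ring_1}") comm_ring_1
proof
  fix s t u :: "'a \<otimes> 'b"
  show "s * t = t * s"
  proof (induction s rule: tensor_induct)
    case (pure a b)
    show ?case
      by (induction t rule: tensor_induct)
         (simp_all add: pure_times_pure mult.commute distrib_left distrib_right)
  qed (simp add: distrib_left distrib_right)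
qed (simp_all add: distrib_right)

definition monomial_value :: "('k \<Rightarrow> 'b::comm_monoid_mult) \<Rightarrow> ('k \<Rightarrow>\<^sub>0 nat) \<Rightarrow> 'b" where
  "monomial_value F M = (\<Prod>k\<in>Poly_Mapping.keys M. F k ^ Poly_Mapping.lookup M k)"

lemma monomial_value_superset:
  assumes "finite S" "Poly_Mapping.keys M \<subseteq> S"
  shows "monomial_value F M = (\<Prod>k\<in>S. F k ^ Poly_Mapping.lookup M k)"
  unfolding monomial_value_def using assms
  by (intro prod.mono_neutral_left) (auto simp: in_keys_iff)

lemma monomial_value_zero [simp]: "monomial_value F 0 = 1"
  by (simp add: monomial_value_def)

lemma monomial_value_single [simp]: "monomial_value F (Poly_Mapping.single k n) = F k ^ n"
  by (simp add: monomial_value_def)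

lemma monomial_value_add: "monomial_value F (M + N) = monomial_value F M * monomial_value F N"
proof -
  let ?S = "Poly_Mapping.keys M \<union> Poly_Mapping.keys N"
  have "Poly_Mapping.keys (M + N) \<subseteq> ?S" by (rule Poly_Mapping.keys_add)
  then show ?thesis
    by (simp add: monomial_value_superset[of ?S] lookup_add power_add prod.distrib)
qed

text \<open>Monomials are characters of the monoid of functions under pointwise product, as
  \<open>independent_characters\<close> demands.\<close>

lemma monomial_value_mult:
  "monomial_value (\<lambda>k. F k * G k) M = monomial_value F M * monomial_value G M"
  by (simp add: monomial_value_def power_mult_distrib prod.distrib)

text \<open>The homomorphism given by the universal property of the free commutative algebra: over
  the reals it is evaluation, over H \<otimes> H it yields the coproduct.\<close>

definition polynomial_value ::
    "('k \<Rightarrow> 'b::{real_algebra_1, comm_ring_1}) \<Rightarrow> (('k \<Rightarrow>\<^sub>0 nat) \<Rightarrow>\<^sub>0 real) \<Rightarrow> 'b" where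
  "polynomial_value F p =
     (\<Sum>M\<in>Poly_Mapping.keys p. Poly_Mapping.lookup p M *\<^sub>R monomial_value F M)"

lemma polynomial_value_superset:
  assumes "finite S" "Poly_Mapping.keys p \<subseteq> S"
  shows "polynomial_value F p = (\<Sum>M\<in>S. Poly_Mapping.lookup p M *\<^sub>R monomial_value F M)"
  unfolding polynomial_value_def using assms
  by (intro sum.mono_neutral_left) (auto simp: in_keys_iff)

lemma polynomial_value_single [simp]:
  "polynomial_value F (Poly_Mapping.single M r) = r *\<^sub>R monomial_value F M"
  by (simp add: polynomial_value_def)

lemma linear_polynomial_value: "linear (polynomial_value F)"
proof (rule linearI)
  fix p q :: "('a \<Rightarrow>\<^sub>0 nat) \<Rightarrow>\<^sub>0 real" and r :: real
  let ?S = "Poly_Mapping.keys p \<union> Poly_Mapping.keys q"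
  have "Poly_Mapping.keys (p + q) \<subseteq> ?S" by (rule Poly_Mapping.keys_add)
  then show "polynomial_value F (p + q) = polynomial_value F p + polynomial_value F q"
    by (simp add: polynomial_value_superset[of ?S] lookup_add scaleR_add_left sum.distrib)
  have "Poly_Mapping.keys (r *\<^sub>R p) \<subseteq> Poly_Mapping.keys p" by (auto simp: in_keys_iff)
  then show "polynomial_value F (r *\<^sub>R p) = r *\<^sub>R polynomial_value F p"
    by (simp add: polynomial_value_superset[of "Poly_Mapping.keys p"] scaleR_sum_right)
qed

lemma unital_algebra_hom_polynomial_value: "unital_algebra_hom (polynomial_value F)"
  unfolding unital_algebra_hom_def
proof (intro conjI allI linear_polynomial_value)
  show "polynomial_value F 1 = 1"
    by (simp flip: single_one)
  fix p q :: "('a \<Rightarrow>\<^sub>0 nat) \<Rightarrow>\<^sub>0 real"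
  note add = linear_add[OF linear_polynomial_value]
  show "polynomial_value F (p * q) = polynomial_value F p * polynomial_value F q"
  proof (induction p rule: poly_mapping_induct_single)
    case (1 M r)
    show ?case
      by (induction q rule: poly_mapping_induct_single)
         (simp_all add: mult_single monomial_value_add distrib_left add)
  qed (simp add: distrib_right add)
qed

lemma unital_algebra_hom_eqI:
  fixes f g :: "(('k \<Rightarrow>\<^sub>0 nat) \<Rightarrow>\<^sub>0 real) \<Rightarrow> 'b::real_algebra_1"
  assumes f: "unital_algebra_hom f" and g: "unital_algebra_hom g"
    and eq: "\<And>k. f (Poly_Mapping.single (Poly_Mapping.single k 1) 1) =
      g (Poly_Mapping.single (Poly_Mapping.single k 1) 1)"
  shows "f = g"
proof
  fix p
  note hom = f[unfolded unital_algebra_hom_def] g[unfolded unital_algebra_hom_def]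
  let ?X = "\<lambda>M. Poly_Mapping.single M (1 :: real) :: ('k \<Rightarrow>\<^sub>0 nat) \<Rightarrow>\<^sub>0 real"
  have X_add: "?X (M + N) = ?X M * ?X N" for M N
    by (simp add: mult_single)
  have monomial: "f (?X M) = g (?X M)" for M
  proof (induction M rule: poly_mapping_induct_single)
    case (1 k n)
    show ?case
    proof (induction n)
      case 0
      then show ?case using hom by simp
    next
      case (Suc n)
      have "Poly_Mapping.single k (Suc n) = Poly_Mapping.single k 1 + Poly_Mapping.single k n"
        by (simp flip: single_add)
      then show ?case using Suc eq hom X_add by simp
    qed
  next
    case (2 M N)
    then show ?case using hom X_add by simp
  qed
  show "f p = g p"
  proof (induction p rule: poly_mapping_induct_single)
    case (1 M r)
    have "Poly_Mapping.single M r = r *\<^sub>R ?X M" by (simp add: scaleR_single)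
    then show ?case using monomial hom by (simp add: linear_scale)
  next
    case (2 p q)
    then show ?case using hom by (simp add: linear_add)
  qed
qed

text \<open>Dedekind's argument: a relation between distinct multiplicative functions, evaluated at
  \<open>m x y\<close> and combined with its multiple by \<open>\<chi>\<^sub>M(y)\<close>, loses the term \<open>\<chi>\<^sub>M\<close>.\<close>

lemma independent_characters:
  fixes \<chi> :: "'i \<Rightarrow> 'x \<Rightarrow> real"
  assumes "finite S"
    and mult: "\<And>i x y. \<chi> i (m x y) = \<chi> i x * \<chi> i y" and one: "\<And>i. \<chi> i e = 1"
    and distinct: "\<And>i j. i \<noteq> j \<Longrightarrow> \<exists>x. \<chi> i x \<noteq> \<chi> j x"
    and zero: "\<And>x. (\<Sum>i\<in>S. a i * \<chi> i x) = 0" and "i \<in> S"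
  shows "a i = 0"
  using assms(1) zero \<open>i \<in> S\<close>
proof (induction S arbitrary: a i rule: finite_induct)
  case (insert j S)
  have a: "a i = 0" if i: "i \<in> S" for i
  proof -
    obtain y where y: "\<chi> i y \<noteq> \<chi> j y" using distinct[of i j] insert.hyps i by auto
    have "(\<Sum>i\<in>S. a i * (\<chi> i y - \<chi> j y) * \<chi> i x) = 0" for x
    proof -
      have "(\<Sum>i\<in>S. a i * (\<chi> i y - \<chi> j y) * \<chi> i x) =
          (\<Sum>i\<in>insert j S. a i * \<chi> i (m x y)) - \<chi> j y * (\<Sum>i\<in>insert j S. a i * \<chi> i x)"
        using insert.hyps
        by (simp add: mult sum_distrib_left sum_subtractf algebra_simps flip: sum.distrib)
      then show ?thesis by (simp only: insert.prems(1) mult_zero_right diff_self)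
    qed
    from insert.IH[of "\<lambda>i. a i * (\<chi> i y - \<chi> j y)", OF this i] y show ?thesis by simp
  qed
  moreover have "a j = 0"
    using insert.prems(1)[of e] insert.hyps a by (simp add: one)
  ultimately show ?case using insert.prems(2) by auto
qed simp

lemma polynomial_value_eq_0_imp:
  assumes "\<And>F :: 'k \<Rightarrow> real. polynomial_value F p = 0"
  shows "p = 0"
proof (rule ccontr)
  assume "p \<noteq> 0"
  then obtain M where M: "M \<in> Poly_Mapping.keys p" by (metis all_not_in_conv keys_eq_empty)
  have "Poly_Mapping.lookup p M = 0"
  proof (rule independent_characters[where \<chi> = "\<lambda>M F. monomial_value F M" and i = M
        and S = "Poly_Mapping.keys p" and m = "\<lambda>F G k. F k * G k" and e = "\<lambda>_. 1"])
    show "(\<Sum>M\<in>Poly_Mapping.keys p. Poly_Mapping.lookup p M * monomial_value F M) = 0" for F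
      using assms[of F] by (simp add: polynomial_value_def)
    show "\<exists>F :: 'k \<Rightarrow> real. monomial_value F M \<noteq> monomial_value F N" if "M \<noteq> N" for M N
    proof -
      obtain k where k: "Poly_Mapping.lookup M k \<noteq> Poly_Mapping.lookup N k"
        using \<open>M \<noteq> N\<close> poly_mapping_eqI[of M N] by auto
      \<comment> \<open>The value 2 at k and 1 elsewhere turns the exponent of k into a power of 2,
        so monomials with different exponents are told apart.\<close>
      have "monomial_value (\<lambda>l. if l = k then 2 else 1 :: real) M = 2 ^ Poly_Mapping.lookup M k" for M
      proof -
        have "monomial_value (\<lambda>l. if l = k then 2 else 1 :: real) M =
            (\<Prod>l\<in>insert k (Poly_Mapping.keys M). if l = k then 2 ^ Poly_Mapping.lookup M k else 1)"
          by (rule trans[OF monomial_value_superset[of "insert k (Poly_Mapping.keys M)"]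
                prod.cong[OF refl]]) auto
        then show ?thesis by simp
      qed
      with k have "monomial_value (\<lambda>l. if l = k then 2 else 1 :: real) M \<noteq>
          monomial_value (\<lambda>l. if l = k then 2 else 1) N" by simp
      then show ?thesis by blast
    qed
  qed (auto simp: M monomial_value_mult monomial_value_def[of "\<lambda>_. 1"])
  with M show False by (simp add: in_keys_iff)
qed

lemma coord_eval_eq_polynomial_value: "coord_eval p c = polynomial_value (\<lambda>(i, \<eta>). c i \<eta>) p"
  by (simp add: coord_eval_def polynomial_value_def monomial_value_def split_def)

lemma unital_algebra_hom_coord_eval: "unital_algebra_hom (\<lambda>p. coord_eval p c)"
  unfolding coord_eval_eq_polynomial_value by (rule unital_algebra_hom_polynomial_value)

lemma coord_eval_separates:
  assumes "\<And>c. coord_eval p c = 0"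
  shows "p = 0"
proof (rule polynomial_value_eq_0_imp)
  show "polynomial_value F p = 0" for F :: "'a \<times> 'a option list \<Rightarrow> real"
    using assms[of "\<lambda>i \<eta>. F (i, \<eta>)"] by (simp add: coord_eval_eq_polynomial_value)
qed

section \<open>Separation of tensors by evaluations\<close>

lemma bilinear_mult_functionals:
  fixes f :: "'a::real_vector \<Rightarrow> real" and g :: "'b::real_vector \<Rightarrow> real"
  assumes "linear f" "linear g"
  shows "bilinear (\<lambda>a b. f a * g b)"
  using assms by (auto simp: bilinear_def linear_add linear_scale algebra_simps intro!: linearI)

text \<open>Expand t over a basis A of the left factor as a sum of \<open>a \<otimes> w a\<close>.
  For fixed y every \<open>f x\<close> vanishes on the sum of \<open>g y (w a) *\<^sub>R a\<close>,
  so this vector is 0 and independence gives \<open>g y (w a) = 0\<close>. As y varies,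
  \<open>w a = 0\<close>.\<close>

lemma tensor_functionals_separate:
  fixes f :: "'x \<Rightarrow> 'a::real_vector \<Rightarrow> real" and g :: "'y \<Rightarrow> 'b::real_vector \<Rightarrow> real"
  assumes f: "\<And>x. linear (f x)" and f_sep: "\<And>a. (\<And>x. f x a = 0) \<Longrightarrow> a = 0"
    and g: "\<And>y. linear (g y)" and g_sep: "\<And>b. (\<And>y. g y b = 0) \<Longrightarrow> b = 0"
    and zero: "\<And>x y. tensor_lift (\<lambda>a b. f x a * g y b) t = 0"
  shows "t = 0"
proof -
  obtain A :: "'a set" where A: "independent A" "UNIV \<subseteq> span A"
    using maximal_independent_subset[of UNIV] by metis
  have "\<exists>S w. finite S \<and> S \<subseteq> A \<and> t = (\<Sum>a\<in>S. a \<otimes> w a)"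
  proof (induction t rule: tensor_induct)
    case (pure v b)
    obtain S r where S: "finite S" "S \<subseteq> A" "v = (\<Sum>a\<in>S. r a *\<^sub>R a)"
      using A(2) unfolding span_explicit by blast
    have "v \<otimes> b = (\<Sum>a\<in>S. (r a *\<^sub>R a) \<otimes> b)"
      unfolding S(3)
      by (rule linear_sum[OF bilinear_pure_tensor[unfolded bilinear_def, THEN conjunct2, THEN spec]])
    then have "v \<otimes> b = (\<Sum>a\<in>S. a \<otimes> (r a *\<^sub>R b))"
      by (simp add: pure_tensor_scaleR_left pure_tensor_scaleR_right)
    with S show ?case by (intro exI[of _ S] exI[of _ "\<lambda>a. r a *\<^sub>R b"]) simp
  next
    case (add s t)
    then obtain S w T w' where S: "finite S" "S \<subseteq> A" "s = (\<Sum>a\<in>S. a \<otimes> w a)"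
      and T: "finite T" "T \<subseteq> A" "t = (\<Sum>a\<in>T. a \<otimes> w' a)" by blast
    let ?w = "\<lambda>a. (if a \<in> S then w a else 0) + (if a \<in> T then w' a else 0)"
    have "s = (\<Sum>a\<in>S \<union> T. a \<otimes> (if a \<in> S then w a else 0))"
      unfolding S(3) using S T
      by (intro sum.mono_neutral_cong_left) (auto simp: bilinear_rzero[OF bilinear_pure_tensor])
    moreover have "t = (\<Sum>a\<in>S \<union> T. a \<otimes> (if a \<in> T then w' a else 0))"
      unfolding T(3) using S T
      by (intro sum.mono_neutral_cong_left) (auto simp: bilinear_rzero[OF bilinear_pure_tensor])
    ultimately have "s + t = (\<Sum>a\<in>S \<union> T. a \<otimes> ?w a)"
      by (simp add: pure_tensor_add_right sum.distrib)
    with S T show ?case by (intro exI[of _ "S \<union> T"] exI[of _ ?w]) simp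
  qed
  then obtain S w where S: "finite S" "S \<subseteq> A" and t: "t = (\<Sum>a\<in>S. a \<otimes> w a)" by blast
  have "g y (w a) = 0" if a: "a \<in> S" for a y
  proof -
    have "(\<Sum>a\<in>S. g y (w a) *\<^sub>R a) = 0"
    proof (rule f_sep)
      fix x
      have "f x (\<Sum>a\<in>S. g y (w a) *\<^sub>R a) = (\<Sum>a\<in>S. f x a * g y (w a))"
        by (simp add: linear_sum[OF f] linear_scale[OF f] mult.commute)
      also have "\<dots> = tensor_lift (\<lambda>a b. f x a * g y b) t"
        by (simp add: t linear_sum[OF linear_tensor_lift] bilinear_mult_functionals f g)
      finally show "f x (\<Sum>a\<in>S. g y (w a) *\<^sub>R a) = 0" by (simp add: zero)
    qed
    then show ?thesis
      using independentD[OF A(1) S, of "\<lambda>a. g y (w a)"] a by simp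
  qed
  then have "w a = 0" if "a \<in> S" for a
    using g_sep that by blast
  then show ?thesis
    by (simp add: t bilinear_rzero[OF bilinear_pure_tensor])
qed

lemma linear_coord_eval2: "linear (\<lambda>t. coord_eval2 t c d)"
  unfolding coord_eval2_def by (rule linear_tensor_lift)

lemma coord_eval2_separates:
  assumes "\<And>c d. coord_eval2 t c d = 0"
  shows "t = 0"
  by (rule tensor_functionals_separate[where f = "\<lambda>c p. coord_eval p c" and g = "\<lambda>d p. coord_eval p d"])
     (use assms coord_eval_separates in \<open>auto simp: linear_coord_eval coord_eval2_def\<close>)

lemma unital_algebra_hom_coord_eval2: "unital_algebra_hom (\<lambda>t. coord_eval2 t c d)"
  unfolding unital_algebra_hom_def
proof (intro conjI allI linear_coord_eval2)
  note hom = unital_algebra_hom_coord_eval[unfolded unital_algebra_hom_def, THEN conjunct2]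
    and add = linear_add[OF linear_coord_eval2]
  show "coord_eval2 1 c d = 1"
    by (simp add: one_tensor_def coord_eval2_pure hom[THEN conjunct1])
  fix s t :: "'a coord_algebra \<otimes> 'a coord_algebra"
  show "coord_eval2 (s * t) c d = coord_eval2 s c d * coord_eval2 t c d"
  proof (induction s rule: tensor_induct)
    case (pure p q)
    show ?case
      by (induction t rule: tensor_induct)
         (simp_all add: pure_times_pure coord_eval2_pure distrib_left add
           hom[THEN conjunct2, rule_format])
  qed (simp add: distrib_right add)
qed

section \<open>The grading\<close>

definition letter_weight :: "'m option \<Rightarrow> nat" where
  "letter_weight x = (case x of None \<Rightarrow> 2 | Some _ \<Rightarrow> 1)"

definition word_weight :: "'m option list \<Rightarrow> nat" where
  "word_weight \<eta> = sum_list (map letter_weight \<eta>)"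

lemma letter_weight_simps [simp]: "letter_weight None = 2" "letter_weight (Some i) = 1"
  by (simp_all add: letter_weight_def)

lemma word_weight_simps [simp]:
  "word_weight [] = 0"
  "word_weight (x # \<eta>) = letter_weight x + word_weight \<eta>"
  "word_weight (\<eta> @ \<xi>) = word_weight \<eta> + word_weight \<xi>"
  by (simp_all add: word_weight_def)

lemma coordinate_degree_eq: "coordinate_degree i \<eta> = word_weight \<eta> + 1"
proof (induction \<eta>)
  case (Cons x \<eta>)
  show ?case
  proof (cases x)
    case (Some j)
    have "count_list (Some j # \<eta>) (Some k) = count_list \<eta> (Some k) + (if k = j then 1 else 0)" for k
      by simp
    then show ?thesis
      using Cons by (simp add: coordinate_degree_def Some sum.distrib del: count_list.simps(2))
        (simp add: count_list.simps(2))
  qed (use Cons in \<open>simp add: coordinate_degree_def\<close>)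
qed (simp add: coordinate_degree_def)

lemma monomial_degree_superset:
  assumes "finite S" "Poly_Mapping.keys M \<subseteq> S"
  shows "monomial_degree M = (\<Sum>(i, \<eta>)\<in>S. Poly_Mapping.lookup M (i, \<eta>) * coordinate_degree i \<eta>)"
  unfolding monomial_degree_def using assms
  by (intro sum.mono_neutral_left) (auto simp: in_keys_iff)

lemma monomial_degree_zero [simp]: "monomial_degree 0 = 0"
  by (simp add: monomial_degree_def)

lemma monomial_degree_single [simp]:
  "monomial_degree (Poly_Mapping.single (i, \<eta>) n) = n * coordinate_degree i \<eta>"
  by (simp add: monomial_degree_def)

lemma monomial_degree_add: "monomial_degree (M + N) = monomial_degree M + monomial_degree N"
proof -
  let ?S = "Poly_Mapping.keys M \<union> Poly_Mapping.keys N"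
  have "Poly_Mapping.keys (M + N) \<subseteq> ?S" by (rule Poly_Mapping.keys_add)
  then show ?thesis
    by (simp add: monomial_degree_superset[of ?S] lookup_add split_def distrib_right sum.distrib)
qed

lemma monomial_degree_eq_0_iff: "monomial_degree M = 0 \<longleftrightarrow> M = 0"
proof
  assume "monomial_degree M = 0"
  then have "\<forall>(i, \<eta>)\<in>Poly_Mapping.keys M. Poly_Mapping.lookup M (i, \<eta>) = 0"
    by (auto simp: monomial_degree_def coordinate_degree_eq)
  then show "M = 0" by (intro poly_mapping_eqI) (auto simp: in_keys_iff)
qed simp

lemma poly_mapping_eq_sum_single:
  "p = (\<Sum>M\<in>Poly_Mapping.keys p. Poly_Mapping.single M (Poly_Mapping.lookup p M))"
  by (rule poly_mapping_eqI) (simp add: lookup_sum lookup_single when_def in_keys_iff)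

text \<open>Trades the span for a condition on the support, from which products and coefficients can
  be read off.\<close>

lemma in_coord_component_iff:
  "p \<in> coord_component n \<longleftrightarrow> (\<forall>M\<in>Poly_Mapping.keys p. monomial_degree M = n)"
proof
  assume "p \<in> coord_component n"
  then show "\<forall>M\<in>Poly_Mapping.keys p. monomial_degree M = n"
    unfolding coord_component_def
  proof (induction rule: span_induct)
    case base
    show ?case
    proof (rule subspaceI)
      fix p q :: "'a coord_algebra" and r :: real
      assume "p \<in> {p. \<forall>M\<in>Poly_Mapping.keys p. monomial_degree M = n}"
      moreover have "Poly_Mapping.keys (r *\<^sub>R p) \<subseteq> Poly_Mapping.keys p" by (auto simp: in_keys_iff)
      ultimately show "r *\<^sub>R p \<in> {p. \<forall>M\<in>Poly_Mapping.keys p. monomial_degree M = n}" by auto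
    qed (use Poly_Mapping.keys_add in fastforce)+
  qed auto
next
  assume p: "\<forall>M\<in>Poly_Mapping.keys p. monomial_degree M = n"
  have "Poly_Mapping.single M r \<in> coord_component n" if "monomial_degree M = n" for M r
  proof -
    have "r *\<^sub>R Poly_Mapping.single M 1 \<in> coord_component n"
      unfolding coord_component_def by (intro span_scale span_base) (use that in auto)
    then show ?thesis by (simp add: scaleR_single)
  qed
  then have "(\<Sum>M\<in>Poly_Mapping.keys p. Poly_Mapping.single M (Poly_Mapping.lookup p M)) \<in> coord_component n"
    using p by (auto simp: coord_component_def intro!: span_sum)
  then show "p \<in> coord_component n" by (subst poly_mapping_eq_sum_single)
qed

lemma subspace_coord_component: "subspace (coord_component n)"
  by (simp add: coord_component_def)

lemma coord_component_mult:
  assumes "p \<in> coord_component k" "q \<in> coord_component l"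
  shows "p * q \<in> coord_component (k + l)"
  unfolding in_coord_component_iff
  using keys_mult[of p q] assms[unfolded in_coord_component_iff] by (auto simp: monomial_degree_add)

lemma coordinate_in_component: "coordinate i \<eta> \<in> coord_component (coordinate_degree i \<eta>)"
  by (simp add: in_coord_component_iff coordinate_def)

lemma one_in_component: "1 \<in> coord_component 0"
  by (simp add: in_coord_component_iff)

lemma coord_component_0: "coord_component 0 = range (\<lambda>r. r *\<^sub>R 1)"
  by (simp add: coord_component_def monomial_degree_eq_0_iff span_singleton)

lemma direct_sum_coord_component: "direct_sum_decomposition coord_component"
  unfolding direct_sum_decomposition_def
proof (intro conjI allI subspace_coord_component)
  fix p :: "'a coord_algebra"
  let ?S = "monomial_degree ` Poly_Mapping.keys p"
  let ?s = "\<lambda>M. Poly_Mapping.single M (Poly_Mapping.lookup p M)"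
  let ?f = "\<lambda>n. \<Sum>M | M \<in> Poly_Mapping.keys p \<and> monomial_degree M = n. ?s M"
  \<comment> \<open>The coefficient at M can come only from the component whose index is the degree
    of M. Applied to \<open>g\<close> and to \<open>?f\<close>, this forces them to
    coincide.\<close>
  have lookup_sum_any: "Poly_Mapping.lookup p M = Poly_Mapping.lookup (g (monomial_degree M)) M"
    if "\<And>n. g n \<in> coord_component n" "finite {n. g n \<noteq> 0}" "p = Sum_any g" for g M
  proof -
    let ?T = "insert (monomial_degree M) {n. g n \<noteq> 0}"
    have "p = sum g ?T"
      unfolding that(3) by (rule Sum_any.expand_superset) (use that(2) in auto)
    then have "Poly_Mapping.lookup p M = (\<Sum>n\<in>?T. Poly_Mapping.lookup (g n) M)"
      by (simp only: lookup_sum)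
    also have "\<dots> = (\<Sum>n\<in>{monomial_degree M}. Poly_Mapping.lookup (g n) M)"
      by (rule sum.mono_neutral_right)
         (use that(1)[unfolded in_coord_component_iff] that(2) in \<open>auto simp: in_keys_iff\<close>)
    finally show ?thesis by simp
  qed
  have f: "?f n \<in> coord_component n" for n
    by (rule subspace_sum[OF subspace_coord_component]) (auto simp: in_coord_component_iff)
  have supp: "{n. ?f n \<noteq> 0} \<subseteq> ?S"
  proof
    fix n assume "n \<in> {n. ?f n \<noteq> 0}"
    then obtain M where "M \<in> Poly_Mapping.keys p \<and> monomial_degree M = n"
      by (metis (mono_tags, lifting) mem_Collect_eq sum.neutral)
    then show "n \<in> ?S" by blast
  qed
  have p: "p = Sum_any ?f"
  proof -
    have "p = (\<Sum>n\<in>?S. ?f n)"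
      by (subst sum.group) (auto simp flip: poly_mapping_eq_sum_single)
    also have "\<dots> = Sum_any ?f"
      by (rule sym[OF Sum_any.expand_superset[OF _ supp]]) simp
    finally show ?thesis .
  qed
  show "\<exists>!f. (\<forall>n. f n \<in> coord_component n) \<and> finite {n. f n \<noteq> 0} \<and> p = Sum_any f"
  proof (rule ex1I[of _ ?f])
    show "(\<forall>n. ?f n \<in> coord_component n) \<and> finite {n. ?f n \<noteq> 0} \<and> p = Sum_any ?f"
      using f p finite_subset[OF supp] by simp
    fix g assume g: "(\<forall>n. g n \<in> coord_component n) \<and> finite {n. g n \<noteq> 0} \<and> p = Sum_any g"
    show "g = ?f"
    proof (rule ext, rule poly_mapping_eqI)
      fix n M
      show "Poly_Mapping.lookup (g n) M = Poly_Mapping.lookup (?f n) M"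
      proof (cases "monomial_degree M = n")
        case True
        have "Poly_Mapping.lookup p M = Poly_Mapping.lookup (g (monomial_degree M)) M"
          by (rule lookup_sum_any) (use g in blast)+
        moreover have "Poly_Mapping.lookup p M = Poly_Mapping.lookup (?f (monomial_degree M)) M"
          by (rule lookup_sum_any[OF f finite_subset[OF supp] p]) simp
        ultimately show ?thesis using True by simp
      next
        case False
        then have "Poly_Mapping.lookup q M = 0" if "q \<in> coord_component n" for q
          using that by (auto simp: in_coord_component_iff in_keys_iff)
        from this[OF f] this[of "g n"] g show ?thesis by metis
      qed
    qed
  qed
qed

lemma graded_tensors_mult:
  fixes B :: "nat \<Rightarrow> 'a::real_algebra_1 set"
  assumes B: "\<And>k l x y. x \<in> B k \<Longrightarrow> y \<in> B l \<Longrightarrow> x * y \<in> B (k + l)"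
    and s: "s \<in> graded_tensors B m" and t: "t \<in> graded_tensors B n"
  shows "s * t \<in> graded_tensors B (m + n)"
  using s
proof (induction rule: span_induct)
  case base
  show ?case
    by (auto simp: subspace_def span_zero span_add span_scale distrib_right)
next
  case (step s)
  then obtain a b k l where s: "s = a \<otimes> b" "k + l = m" "a \<in> B k" "b \<in> B l" by blast
  show ?case
    using t
  proof (induction rule: span_induct)
    case base
    show ?case
      by (auto simp: subspace_def span_zero span_add span_scale distrib_left)
  next
    case (step t)
    then obtain a' b' k' l' where t: "t = a' \<otimes> b'" "k' + l' = n" "a' \<in> B k'" "b' \<in> B l'" by blast
    have "(a * a') \<otimes> (b * b') \<in> graded_tensors B (m + n)"
    proof (rule span_base, intro CollectI exI conjI)
      show "(k + k') + (l + l') = m + n" using s t by simp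
    qed (use s t B in auto)
    then show ?case by (simp add: s t pure_times_pure)
  qed
qed

section \<open>The coproduct of a coordinate function\<close>

text \<open>Hides the representing tensor, which evaluations determine uniquely, so that degrees can
  be tracked through sums and products of real-valued functions.\<close>

definition homogeneous ::
    "nat \<Rightarrow> (('m::finite \<Rightarrow> 'm option series) \<Rightarrow> ('m \<Rightarrow> 'm option series) \<Rightarrow> real) \<Rightarrow> bool" where
  "homogeneous n F \<longleftrightarrow>
     (\<exists>t\<in>graded_tensors coord_component n. \<forall>c d. coord_eval2 t c d = F c d)"

lemma homogeneous_zero: "homogeneous n (\<lambda>_ _. 0)"
  unfolding homogeneous_def
  by (rule bexI[of _ 0]) (auto simp: span_zero linear_0[OF linear_coord_eval2])

lemma homogeneous_add:
  assumes "homogeneous n F" "homogeneous n G"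
  shows "homogeneous n (\<lambda>c d. F c d + G c d)"
proof -
  obtain s t where "s \<in> graded_tensors coord_component n" "\<forall>c d. coord_eval2 s c d = F c d"
    "t \<in> graded_tensors coord_component n" "\<forall>c d. coord_eval2 t c d = G c d"
    using assms unfolding homogeneous_def by blast
  then show ?thesis
    unfolding homogeneous_def
    by (intro bexI[of _ "s + t"]) (auto simp: span_add linear_add[OF linear_coord_eval2])
qed

lemma homogeneous_sum:
  assumes "\<And>i. i \<in> I \<Longrightarrow> homogeneous n (F i)"
  shows "homogeneous n (\<lambda>c d. \<Sum>i\<in>I. F i c d)"
  using assms
  by (induction I rule: infinite_finite_induct) (auto simp: homogeneous_zero homogeneous_add)

lemma homogeneous_mult:
  assumes "homogeneous m F" "homogeneous n G"
  shows "homogeneous (m + n) (\<lambda>c d. F c d * G c d)"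
proof -
  obtain s t where st: "s \<in> graded_tensors coord_component m" "\<forall>c d. coord_eval2 s c d = F c d"
    "t \<in> graded_tensors coord_component n" "\<forall>c d. coord_eval2 t c d = G c d"
    using assms unfolding homogeneous_def by blast
  have "coord_eval2 (s * t) c d = coord_eval2 s c d * coord_eval2 t c d" for c d
    using unital_algebra_hom_coord_eval2[of c d] by (simp add: unital_algebra_hom_def)
  then show ?thesis
    unfolding homogeneous_def
    by (intro bexI[of _ "s * t"] graded_tensors_mult[OF coord_component_mult st(1,3)])
       (simp add: st(2,4))
qed

lemma coord_eval_one: "coord_eval 1 c = 1"
  using unital_algebra_hom_coord_eval[of c] by (simp add: unital_algebra_hom_def)

lemma homogeneous_coordinate_left: "homogeneous (word_weight \<eta> + 1) (\<lambda>c d. c i \<eta>)"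
  unfolding homogeneous_def
proof (rule bexI)
  show "\<forall>c d. coord_eval2 (coordinate i \<eta> \<otimes> 1) c d = c i \<eta>"
    by (simp add: coord_eval2_pure coord_eval_coordinate coord_eval_one)
  show "coordinate i \<eta> \<otimes> 1 \<in> graded_tensors coord_component (word_weight \<eta> + 1)"
    by (rule span_base)
       (use coordinate_in_component[of i \<eta>] one_in_component coordinate_degree_eq[of i \<eta>]
         in \<open>metis (mono_tags, lifting) add_0_right mem_Collect_eq\<close>)
qed

lemma homogeneous_coordinate_right: "homogeneous (word_weight \<eta> + 1) (\<lambda>c d. d i \<eta>)"
  unfolding homogeneous_def
proof (rule bexI)
  show "\<forall>c d. coord_eval2 (1 \<otimes> coordinate i \<eta>) c d = d i \<eta>"
    by (simp add: coord_eval2_pure coord_eval_coordinate coord_eval_one)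
  show "1 \<otimes> coordinate i \<eta> \<in> graded_tensors coord_component (word_weight \<eta> + 1)"
    by (rule span_base)
       (use coordinate_in_component[of i \<eta>] one_in_component coordinate_degree_eq[of i \<eta>]
         in \<open>metis (mono_tags, lifting) add_0_left mem_Collect_eq\<close>)
qed

text \<open>The coefficient of a shuffle product at \<open>\<zeta>\<close> only pairs words whose weights add up to that
  of \<open>\<zeta>\<close>; the offsets \<open>k\<close> and \<open>l\<close> absorb the letters removed by left derivatives.\<close>

lemma homogeneous_shuffle:
  assumes "\<And>\<eta>. length \<eta> \<le> length \<zeta> \<Longrightarrow> homogeneous (k + word_weight \<eta>) (F \<eta>)"
    and "\<And>\<eta>. length \<eta> \<le> length \<zeta> \<Longrightarrow> homogeneous (l + word_weight \<eta>) (G \<eta>)"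
  shows "homogeneous (k + l + word_weight \<zeta>) (\<lambda>c d. shuffle (\<lambda>\<eta>. F \<eta> c d) (\<lambda>\<eta>. G \<eta> c d) \<zeta>)"
  using assms
proof (induction \<zeta> arbitrary: F G k l)
  case Nil
  show ?case
    using homogeneous_mult[OF Nil(1)[of "[]"] Nil(2)[of "[]"]] by (simp add: shuffle_Nil)
next
  case (Cons z \<zeta>)
  let ?w = "letter_weight z"
  have "homogeneous ((k + ?w) + l + word_weight \<zeta>)
      (\<lambda>c d. shuffle (\<lambda>\<eta>. F (z # \<eta>) c d) (\<lambda>\<eta>. G \<eta> c d) \<zeta>)"
    using Cons.prems(1)[of "z # _"] Cons.prems(2) by (intro Cons.IH) (auto simp: add.assoc)
  moreover have "homogeneous (k + (l + ?w) + word_weight \<zeta>)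
      (\<lambda>c d. shuffle (\<lambda>\<eta>. F \<eta> c d) (\<lambda>\<eta>. G (z # \<eta>) c d) \<zeta>)"
    using Cons.prems(2)[of "z # _"] Cons.prems(1) by (intro Cons.IH) (auto simp: add.assoc)
  ultimately show ?case
    by (auto simp: shuffle_Cons lderiv_def ac_simps intro: homogeneous_add)
qed

text \<open>The prefix \<alpha> collects the letters already removed from c: a left derivative of
  \<open>\<lambda>\<eta>. c i (\<alpha> @ \<eta>)\<close> has the same form with one more letter at
  the end of \<alpha>. This closes the induction.\<close>

lemma homogeneous_compose:
  "homogeneous (word_weight \<alpha> + word_weight \<xi> + 1) (\<lambda>c d. compose (\<lambda>\<eta>. c i (\<alpha> @ \<eta>)) d \<xi>)"
proof (induction \<xi> arbitrary: \<alpha> rule: measure_induct_rule[of length])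
  case (less \<xi>)
  show ?case
  proof (cases \<xi>)
    case Nil
    then show ?thesis using homogeneous_coordinate_left[of \<alpha> i] by (simp add: compose_Nil)
  next
    case (Cons y \<xi>')
    let ?c = "\<lambda>x c. \<lambda>\<eta>. c i ((\<alpha> @ [x]) @ \<eta>)"
    have deriv: "lderiv x (\<lambda>\<eta>. c i (\<alpha> @ \<eta>)) = ?c x c" for x c
      by (simp add: lderiv_def)
    have "homogeneous (word_weight (\<alpha> @ [y]) + word_weight \<xi>' + 1) (\<lambda>c d. compose (?c y c) d \<xi>')"
      by (rule less) (simp add: Cons)
    then have 1: "homogeneous (word_weight \<alpha> + word_weight \<xi> + 1) (\<lambda>c d. compose (?c y c) d \<xi>')"
      by (simp add: Cons add.assoc)
    \<comment> \<open>The offset 1 belongs to the coordinate of \<open>d j\<close>, the offset 2 to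
      the letter \<open>Some j\<close> and to the coordinate of c. Their total 3 is the weight 2 of
      x_0 plus the final 1.\<close>
    have "homogeneous (1 + (word_weight \<alpha> + 2) + word_weight \<xi>')
        (\<lambda>c d. shuffle (\<lambda>\<eta>. d j \<eta>) (\<lambda>\<eta>. compose (?c (Some j) c) d \<eta>) \<xi>')" for j
    proof (rule homogeneous_shuffle)
      show "homogeneous (1 + word_weight \<eta>) (\<lambda>c d. d j \<eta>)" for \<eta>
        using homogeneous_coordinate_right[of \<eta> j] by (simp add: add.commute)
      show "homogeneous (word_weight \<alpha> + 2 + word_weight \<eta>) (\<lambda>c d. compose (?c (Some j) c) d \<eta>)"
        if "length \<eta> \<le> length \<xi>'" for \<eta>
        using less[of \<eta> "\<alpha> @ [Some j]"] that by (simp add: Cons ac_simps)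
    qed
    then have 2: "homogeneous (word_weight \<alpha> + word_weight \<xi> + 1)
        (\<lambda>c d. if y = None then \<Sum>j\<in>UNIV. shuffle (d j) (compose (?c (Some j) c) d) \<xi>' else 0)"
      by (cases y) (auto simp: Cons homogeneous_zero ac_simps intro!: homogeneous_sum)
    show ?thesis
      using homogeneous_add[OF 1 2] by (simp only: Cons compose_Cons deriv)
  qed
qed

lemma homogeneous_composition_group_product:
  "homogeneous (coordinate_degree i \<xi>) (\<lambda>c d. (c \<circledcirc> d) i \<xi>)"
  unfolding coordinate_degree_eq composition_group_product_eq
  using homogeneous_compose[of "[]" \<xi> i]
  by (intro homogeneous_add homogeneous_coordinate_right) simp

section \<open>Existence and uniqueness of coproduct and counit\<close>

lemma coproduct_exists: "\<exists>\<Delta>. is_coproduct (\<Delta> :: 'm::finite coord_algebra \<Rightarrow> 'm coord_algebra \<otimes> 'm coord_algebra)"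
proof -
  have "\<forall>k. \<exists>t :: 'm coord_algebra \<otimes> 'm coord_algebra.
      \<forall>c d. coord_eval2 t c d = (c \<circledcirc> d) (fst k) (snd k)"
    using homogeneous_composition_group_product unfolding homogeneous_def by blast
  then obtain T :: "'m \<times> 'm option list \<Rightarrow> 'm coord_algebra \<otimes> 'm coord_algebra"
    where T: "\<And>k c d. coord_eval2 (T k) c d = (c \<circledcirc> d) (fst k) (snd k)"
    by metis
  \<comment> \<open>The algebra is free on the coordinates, so tensors chosen for these alone extend
    to a homomorphism.\<close>
  have "is_coproduct (polynomial_value T)"
    by (simp add: is_coproduct_def unital_algebra_hom_polynomial_value coordinate_def T)
  then show ?thesis by blast
qed

lemma counit_exists: "is_counit (\<lambda>p. coord_eval p (\<lambda>_ _. 0))"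
  by (simp add: is_counit_def unital_algebra_hom_coord_eval coord_eval_coordinate)

lemma unital_algebra_hom_compose:
  "unital_algebra_hom f \<Longrightarrow> unital_algebra_hom g \<Longrightarrow> unital_algebra_hom (\<lambda>x. g (f x))"
  using linear_compose[of f g] by (simp add: unital_algebra_hom_def o_def)

lemma coord_hom_eqI:
  assumes "unital_algebra_hom f" "unital_algebra_hom g"
    and "\<And>i \<eta>. f (coordinate i \<eta>) = g (coordinate i \<eta>)"
  shows "f = g"
  using assms by (intro unital_algebra_hom_eqI) (auto simp: coordinate_def)

lemma coord_eval2_inject:
  assumes "\<And>c d. coord_eval2 s c d = coord_eval2 t c d"
  shows "s = t"
  using coord_eval2_separates[of "s - t"] assms by (simp add: linear_diff[OF linear_coord_eval2])

lemma coord_eval_inject: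
  assumes "\<And>c. coord_eval p c = coord_eval q c"
  shows "p = q"
  using coord_eval_separates[of "p - q"] assms by (simp add: linear_diff[OF linear_coord_eval])

lemma coproduct_unique:
  assumes "is_coproduct \<Delta>" "is_coproduct \<Delta>'"
  shows "\<Delta> = \<Delta>'"
  using assms by (intro coord_hom_eqI coord_eval2_inject) (auto simp: is_coproduct_def)

lemma counit_unique:
  assumes "is_counit \<epsilon>" "is_counit \<epsilon>'"
  shows "\<epsilon> = \<epsilon>'"
  using assms by (intro coord_hom_eqI) (auto simp: is_counit_def)

text \<open>Prescribed on generators only, the formula extends because both sides are algebra
  homomorphisms in p.\<close>

lemma coord_eval2_coproduct:
  assumes "is_coproduct \<Delta>"
  shows "coord_eval2 (\<Delta> p) c d = coord_eval p (c \<circledcirc> d)"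
proof -
  have "(\<lambda>p. coord_eval2 (\<Delta> p) c d) = (\<lambda>p. coord_eval p (c \<circledcirc> d))"
    using assms
    by (intro coord_hom_eqI unital_algebra_hom_compose[OF _ unital_algebra_hom_coord_eval2]
        unital_algebra_hom_coord_eval)
       (auto simp: is_coproduct_def coord_eval_coordinate)
  then show ?thesis by (rule fun_cong)
qed

section \<open>The bialgebra axioms, tested on triples of series\<close>

definition coord_eval3 ::
    "'m coord_algebra \<otimes> ('m coord_algebra \<otimes> 'm coord_algebra) \<Rightarrow> ('m \<Rightarrow> 'm option series)
       \<Rightarrow> ('m \<Rightarrow> 'm option series) \<Rightarrow> ('m \<Rightarrow> 'm option series) \<Rightarrow> real" where
  "coord_eval3 u c d e = tensor_lift (\<lambda>p t. coord_eval p c * coord_eval2 t d e) u"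

lemma linear_coord_eval3: "linear (\<lambda>u. coord_eval3 u c d e)"
  unfolding coord_eval3_def by (rule linear_tensor_lift)

lemma coord_eval3_pure: "coord_eval3 (p \<otimes> t) c d e = coord_eval p c * coord_eval2 t d e"
  by (simp add: coord_eval3_def bilinear_mult_functionals linear_coord_eval linear_coord_eval2)

text \<open>Separation once more, where the functionals on the right factor are evaluations at
  pairs, which separate H \<otimes> H by \<open>coord_eval2_separates\<close>.\<close>

lemma coord_eval3_inject:
  assumes "\<And>c d e. coord_eval3 s c d e = coord_eval3 t c d e"
  shows "s = t"
proof -
  have "s - t = 0"
  proof (rule tensor_functionals_separate[where f = "\<lambda>c p. coord_eval p c"
        and g = "\<lambda>(d, e) t. coord_eval2 t d e"])
    show "tensor_lift (\<lambda>p u. coord_eval p c * (case y of (d, e) \<Rightarrow> \<lambda>t. coord_eval2 t d e) u) (s - t) = 0"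
      for c y
      using assms by (cases y) (simp add: linear_diff[OF linear_coord_eval3] flip: coord_eval3_def)
  qed (auto simp: linear_coord_eval linear_coord_eval2 intro: coord_eval_separates coord_eval2_separates)
  then show ?thesis by simp
qed

lemma bialgebra_coord:
  assumes \<Delta>: "is_coproduct \<Delta>" and \<epsilon>: "is_counit \<epsilon>"
  shows "bialgebra \<Delta> (\<epsilon> :: 'a::finite coord_algebra \<Rightarrow> real)"
proof
  show hom: "unital_algebra_hom \<Delta>" and hom': "unital_algebra_hom \<epsilon>"
    using assms by (auto simp: is_coproduct_def is_counit_def)
  then have lin: "linear \<Delta>" "linear \<epsilon>" by (auto simp: unital_algebra_hom_def)
  note eval = coord_eval2_coproduct[OF \<Delta>]
  have \<epsilon>_eval: "\<epsilon> p = coord_eval p (\<lambda>_ _. 0)" for p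
    using counit_unique[OF \<epsilon> counit_exists] by simp
  fix h :: "'a coord_algebra"
  show "tensor_assoc (tensor_map \<Delta> id (\<Delta> h)) = tensor_map id \<Delta> (\<Delta> h)"
  proof (rule coord_eval3_inject)
    fix c d e :: "'a \<Rightarrow> 'a option series"
    \<comment> \<open>\<open>tensor_assoc\<close> computes on nested pure tensors, while \<Delta>
      puts a general tensor into the left slot; linearity in that slot bridges the gap.\<close>
    have assoc: "(\<lambda>s. coord_eval3 (tensor_assoc (s \<otimes> b)) c d e) =
        (\<lambda>s. coord_eval2 s c d * coord_eval b e)" for b
    proof (rule tensor_linear_eqI)
      show "linear (\<lambda>s. coord_eval3 (tensor_assoc (s \<otimes> b)) c d e)"
        by (auto intro!: linearI simp: linear_add[OF linear_tensor_assoc] linear_scale[OF linear_tensor_assoc]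
            linear_add[OF linear_coord_eval3] linear_scale[OF linear_coord_eval3]
            pure_tensor_add_left pure_tensor_scaleR_left)
      show "linear (\<lambda>s. coord_eval2 s c d * coord_eval b e)"
        by (auto intro!: linearI simp: linear_add[OF linear_coord_eval2] linear_scale[OF linear_coord_eval2]
            algebra_simps)
    qed (simp add: coord_eval3_pure coord_eval2_pure)
    \<comment> \<open>Splitting the left factor merges the first two series into c \<circledcirc> d;
      splitting the right factor, below, merges the last two.\<close>
    have "(\<lambda>t. coord_eval3 (tensor_assoc (tensor_map \<Delta> id t)) c d e) = (\<lambda>t. coord_eval2 t (c \<circledcirc> d) e)"
    proof (rule tensor_linear_eqI)
      show "linear (\<lambda>t. coord_eval3 (tensor_assoc (tensor_map \<Delta> id t)) c d e)"
        by (rule linear_compose[OF linear_compose[OF linear_tensor_map linear_tensor_assoc]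
              linear_coord_eval3, unfolded o_def])
    qed (simp_all add: linear_coord_eval2 lin linear_id coord_eval2_pure eval fun_cong[OF assoc])
    moreover have "(\<lambda>t. coord_eval3 (tensor_map id \<Delta> t) c d e) = (\<lambda>t. coord_eval2 t c (d \<circledcirc> e))"
    proof (rule tensor_linear_eqI)
      show "linear (\<lambda>t. coord_eval3 (tensor_map id \<Delta> t) c d e)"
        by (rule linear_compose[OF linear_tensor_map linear_coord_eval3, unfolded o_def])
    qed (simp_all add: linear_coord_eval2 lin linear_id coord_eval2_pure coord_eval3_pure eval)
    ultimately show "coord_eval3 (tensor_assoc (tensor_map \<Delta> id (\<Delta> h))) c d e =
        coord_eval3 (tensor_map id \<Delta> (\<Delta> h)) c d e"
      by (simp add: fun_eq_iff eval composition_group_product_assoc)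
  qed
  show "tensor_lift (\<lambda>r x. r *\<^sub>R x) (tensor_map \<epsilon> id (\<Delta> h)) = h"
  proof (rule coord_eval_inject)
    fix c
    have "(\<lambda>t. coord_eval (tensor_lift (\<lambda>r x. r *\<^sub>R x) (tensor_map \<epsilon> id t)) c) =
        (\<lambda>t. coord_eval2 t (\<lambda>_ _. 0) c)"
    proof (rule tensor_linear_eqI)
      show "linear (\<lambda>t. coord_eval (tensor_lift (\<lambda>r x. r *\<^sub>R x) (tensor_map \<epsilon> id t)) c)"
        by (rule linear_compose[OF linear_tensor_compose linear_coord_eval, unfolded o_def])
    qed (simp_all add: linear_coord_eval2 lin linear_id coord_eval2_pure bilinear_scaleR_left
        linear_scale[OF linear_coord_eval] \<epsilon>_eval)
    then show "coord_eval (tensor_lift (\<lambda>r x. r *\<^sub>R x) (tensor_map \<epsilon> id (\<Delta> h))) c = coord_eval h c"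
      by (simp add: fun_eq_iff eval zero_composition_group_product)
  qed
  show "tensor_lift (\<lambda>x r. r *\<^sub>R x) (tensor_map id \<epsilon> (\<Delta> h)) = h"
  proof (rule coord_eval_inject)
    fix c
    have "(\<lambda>t. coord_eval (tensor_lift (\<lambda>x r. r *\<^sub>R x) (tensor_map id \<epsilon> t)) c) =
        (\<lambda>t. coord_eval2 t c (\<lambda>_ _. 0))"
    proof (rule tensor_linear_eqI)
      show "linear (\<lambda>t. coord_eval (tensor_lift (\<lambda>x r. r *\<^sub>R x) (tensor_map id \<epsilon> t)) c)"
        by (rule linear_compose[OF linear_tensor_compose linear_coord_eval, unfolded o_def])
    qed (simp_all add: linear_coord_eval2 lin linear_id coord_eval2_pure bilinear_scaleR_right
        linear_scale[OF linear_coord_eval] \<epsilon>_eval)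
    then show "coord_eval (tensor_lift (\<lambda>x r. r *\<^sub>R x) (tensor_map id \<epsilon> (\<Delta> h))) c = coord_eval h c"
      by (simp add: fun_eq_iff eval composition_group_product_zero)
  qed
qed

section \<open>Compatibility of the coproduct with the grading, and the conclusion\<close>

lemma coproduct_graded:
  assumes \<Delta>: "is_coproduct \<Delta>" and p: "p \<in> (coord_component n :: 'a::finite coord_algebra set)"
  shows "\<Delta> p \<in> graded_tensors coord_component n"
proof -
  have hom: "linear \<Delta>" "\<Delta> 1 = 1" "\<And>p q. \<Delta> (p * q) = \<Delta> p * \<Delta> q"
    using \<Delta> by (auto simp: is_coproduct_def unital_algebra_hom_def)
  let ?X = "\<lambda>M. Poly_Mapping.single M (1 :: real)"
  have mult: "s * t \<in> graded_tensors coord_component (k + l)"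
    if "s \<in> graded_tensors coord_component k" "t \<in> graded_tensors coord_component l"
    for s t :: "'a coord_algebra \<otimes> 'a coord_algebra" and k l
    by (rule graded_tensors_mult[OF coord_component_mult that])
  have X_add: "?X (M + N) = ?X M * ?X N" for M N :: "'a coord_monomial"
    by (simp add: mult_single)
  have coordinate: "\<Delta> (coordinate i \<eta>) \<in> graded_tensors coord_component (coordinate_degree i \<eta>)" for i \<eta>
  proof -
    obtain t where t: "t \<in> graded_tensors coord_component (coordinate_degree i \<eta>)"
      "\<And>c d. coord_eval2 t c d = (c \<circledcirc> d) i \<eta>"
      using homogeneous_composition_group_product[of i \<eta>] unfolding homogeneous_def by blast
    \<comment> \<open>Only the values of \<open>t\<close> are known, but \<Delta> has the same ones
      on this generator, so separation identifies the two and \<Delta> inherits the degree.\<close>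
    have "\<Delta> (coordinate i \<eta>) = t"
      using \<Delta> t(2) by (intro coord_eval2_inject) (simp add: is_coproduct_def)
    with t(1) show ?thesis by simp
  qed
  have one: "1 \<in> graded_tensors coord_component 0"
    unfolding one_tensor_def using one_in_component by (intro span_base) fastforce
  have monomial: "\<Delta> (?X M) \<in> graded_tensors coord_component (monomial_degree M)" for M
  proof (induction M rule: poly_mapping_induct_single)
    case (1 k n)
    obtain i \<eta> where k: "k = (i, \<eta>)" by (cases k)
    show ?case
    proof (induction n)
      case 0
      then show ?case using one hom(2) by simp
    next
      case (Suc n)
      have "Poly_Mapping.single k (Suc n) = Poly_Mapping.single k 1 + Poly_Mapping.single k n"
        by (simp flip: single_add)
      then show ?case
        using mult[OF coordinate[of i \<eta>] Suc] by (simp add: k X_add hom coordinate_def monomial_degree_add)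
    qed
  next
    case (2 M N)
    then show ?case using mult[OF 2] by (simp add: X_add hom monomial_degree_add)
  qed
  show ?thesis
    using p unfolding coord_component_def[of n]
  proof (induction rule: span_induct)
    case base
    show ?case
      by (auto simp: subspace_def hom linear_0 linear_add linear_scale span_zero span_add span_scale)
  qed (use monomial in auto)
qed

theorem theorem3:
  shows "(\<exists>!\<Delta> :: 'm::finite coord_algebra \<Rightarrow> 'm coord_algebra \<otimes> 'm coord_algebra. is_coproduct \<Delta>) \<and>
    (\<exists>!\<epsilon> :: 'm coord_algebra \<Rightarrow> real. is_counit \<epsilon>) \<and>
    (\<forall>(\<Delta> :: 'm coord_algebra \<Rightarrow> 'm coord_algebra \<otimes> 'm coord_algebra) \<epsilon>.
       is_coproduct \<Delta> \<longrightarrow> is_counit \<epsilon> \<longrightarrow>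
       connected_graded_commutative_hopf_algebra \<Delta> \<epsilon> coord_component)"
proof (intro conjI allI impI)
  show "\<exists>!\<Delta> :: 'm coord_algebra \<Rightarrow> 'm coord_algebra \<otimes> 'm coord_algebra. is_coproduct \<Delta>"
    using coproduct_exists coproduct_unique by blast
  show "\<exists>!\<epsilon> :: 'm coord_algebra \<Rightarrow> real. is_counit \<epsilon>"
    using counit_exists counit_unique by blast
  fix \<Delta> :: "'m coord_algebra \<Rightarrow> 'm coord_algebra \<otimes> 'm coord_algebra" and \<epsilon> :: "'m coord_algebra \<Rightarrow> real"
  assume \<Delta>: "is_coproduct \<Delta>" and \<epsilon>: "is_counit \<epsilon>"
  interpret bialgebra \<Delta> \<epsilon> by (rule bialgebra_coord[OF \<Delta> \<epsilon>])
  interpret graded_bialgebra \<Delta> \<epsilon> coord_component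
    by unfold_locales
       (use direct_sum_coord_component coord_component_mult coproduct_graded[OF \<Delta>] in auto)
  interpret hopf_algebra \<Delta> \<epsilon>
    by (rule hopf_algebra_connected[OF coord_component_0])
  show "connected_graded_commutative_hopf_algebra \<Delta> \<epsilon> coord_component"
    by unfold_locales (auto simp: coord_component_0 mult.commute)
qed

end
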